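(* Let $H$, $\{e_j\}_{j\in\mathbb Z}$, $P_m$, $\mathcal A=B_0(H)$, $W=\{W_j\}_{j\in\mathbb Z}$, $U$, $\ell_2(\mathcal A)$ and $T_{U,W}$ be as in the context. Let $(t_n)_{n\in\mathbb N}$ be an unbounded sequence of nonnegative integers, and put $T_{U,W,n}:=T_{U,W}^{t_n}$ for all $n\in\mathbb N$. Then the following are equivalent: (1) $(T_{U,W,n})_n$ is a densely hypercyclic sequence on $\ell_2(\mathcal A)$. (2) For every $J,m\in\mathbb N$ there exist a strictly increasing sequence $\{n_k\}_k\subseteq\mathbb N$ and, for every $i\in[J]$, sequences $\{D_i^{(k)}\}_k$ and $\{G_i^{(k)}\}_k$ of operators in $B_0(H)$ such that for all $j\in[J]$ $$\lim_{k\to\infty}\|D_j^{(k)}-P_m\|=\lim_{k\to\infty}\|G_j^{(k)}-P_m\|=0$$ and $$\lim_{k\to\infty}\|W_{j+t_{n_k}}W_{j+t_{n_k}-1}\cdots W_{j+1}D_j^{(k)}\|=\lim_{k\to\infty}\|W_{j-t_{n_k}+1}^{-1}W_{j-t_{n_k}+2}^{-1}\cdots W_j^{-1}G_j^{(k)}\|=0.$$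
   Context: $\mathbb N=\{1,2,\dots\}$. For $J\in\mathbb N$, $[J]:=\{-J,-J+1,\dots,J-1,J\}$. $H$ is a separable Hilbert space with an orthonormal basis $\{e_j\}_{j\in\mathbb Z}$; for $m\in\mathbb N$, $P_m$ is the orthogonal projection of $H$ onto $\mathrm{Span}\{e_{-m},\dots,e_m\}$. $B(H)$ is the $C^*$-algebra of bounded operators on $H$ and $\mathcal A:=B_0(H)$ is the $C^*$-algebra of compact operators on $H$. $W=\{W_j\}_{j\in\mathbb Z}$ is a uniformly bounded sequence of invertible operators in $B(H)$ such that $\{W_j^{-1}\}_{j\in\mathbb Z}$ is also uniformly bounded, and $U$ is a unitary operator on $H$. $\ell_2(\mathcal A)$ is the standard right Hilbert module over $\mathcal A$ indexed by $\mathbb Z$: the sequences $x=(x_j)_{j\in\mathbb Z}$ in $\mathcal A$ such that $\sum_j x_j^*x_j$ converges in norm in $\mathcal A$, with $\langle x,y\rangle=\sum_j x_j^*y_j$ and norm $\|x\|_2=\|\langle x,x\rangle\|^{1/2}$. $T_{U,W}$ is the (bounded, invertible) linear operator on $\ell_2(\mathcal A)$ given by $(T_{U,W}(x))_\xi:=W_\xi\,x_{\xi-1}\,U$ for $\xi\in\mathbb Z$. A sequence $(T_n)_n$ of bounded linear operators on a Banach space $\mathcal X$ is densely hypercyclic if the set of vectors $x\in\mathcal X$ for which the orbit $\{T_nx\}_n$ is dense in $\mathcal X$ is itself dense in $\mathcal X$. *)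

theory Defs
  imports "HOL-Analysis.Analysis"
begin

text \<open>Complex Hilbert spaces; the inner product is conjugate-linear in its first argument.\<close>

class complex_hilbert = banach +
  fixes scaleC :: "complex \<Rightarrow> 'a \<Rightarrow> 'a" (infixr "*\<^sub>C" 75)
    and cinner :: "'a \<Rightarrow> 'a \<Rightarrow> complex"
  assumes scaleC_add_right: "c *\<^sub>C (x + y) = c *\<^sub>C x + c *\<^sub>C y"
    and scaleC_add_left: "(c + d) *\<^sub>C x = c *\<^sub>C x + d *\<^sub>C x"
    and scaleC_scaleC: "c *\<^sub>C d *\<^sub>C x = (c * d) *\<^sub>C x"
    and scaleC_one: "1 *\<^sub>C x = x"
    and scaleR_scaleC: "r *\<^sub>R x = complex_of_real r *\<^sub>C x"
    and cinner_commute: "cinner x y = cnj (cinner y x)"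
    and cinner_add_right: "cinner x (y + z) = cinner x y + cinner x z"
    and cinner_scaleC_right: "cinner x (c *\<^sub>C y) = c * cinner x y"
    and cinner_ge_zero: "0 \<le> Re (cinner x x)"
    and norm_eq_sqrt_cinner: "norm x = sqrt (Re (cinner x x))"

interpretation complex_vector: vector_space "scaleC :: complex \<Rightarrow> 'h \<Rightarrow> 'h::complex_hilbert"
  by unfold_locales
    (simp_all add: scaleC_add_right scaleC_add_left scaleC_scaleC scaleC_one)

definition orthonormal_basis :: "('i \<Rightarrow> 'h::complex_hilbert) \<Rightarrow> bool" where
  "orthonormal_basis e \<longleftrightarrow>
     (\<forall>i j. cinner (e i) (e j) = (if i = j then 1 else 0)) \<and>
     closure (complex_vector.span (range e)) = UNIV"

text \<open>
  The type \<open>'h \<Rightarrow>\<^sub>L 'h\<close> consists of the bounded real-linear maps. Hence \<open>B(H)\<close> is the subset of its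
  complex-linear members; the norm of \<open>'h \<Rightarrow>\<^sub>L 'h\<close> is the operator norm.
\<close>

definition bounded_ops :: "('h::complex_hilbert \<Rightarrow>\<^sub>L 'h) set" where
  "bounded_ops = {T. \<forall>c x. blinfun_apply T (c *\<^sub>C x) = c *\<^sub>C blinfun_apply T x}"

definition compact_ops :: "('h::complex_hilbert \<Rightarrow>\<^sub>L 'h) set" where
  "compact_ops = {T \<in> bounded_ops. compact (closure (blinfun_apply T ` cball 0 1))}"

definition op_adjoint :: "('h::complex_hilbert \<Rightarrow>\<^sub>L 'h) \<Rightarrow> ('h \<Rightarrow>\<^sub>L 'h)" where
  "op_adjoint T = (THE S. \<forall>x y. cinner (blinfun_apply S x) y = cinner x (blinfun_apply T y))"

definition unitary_op :: "('h::complex_hilbert \<Rightarrow>\<^sub>L 'h) \<Rightarrow> bool" where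
  "unitary_op U \<longleftrightarrow> U \<in> bounded_ops \<and>
     op_adjoint U o\<^sub>L U = id_blinfun \<and> U o\<^sub>L op_adjoint U = id_blinfun"

definition invertible_op :: "('h::complex_hilbert \<Rightarrow>\<^sub>L 'h) \<Rightarrow> bool" where
  "invertible_op T \<longleftrightarrow> T \<in> bounded_ops \<and>
     (\<exists>S\<in>bounded_ops. S o\<^sub>L T = id_blinfun \<and> T o\<^sub>L S = id_blinfun)"

definition op_inverse :: "('h::complex_hilbert \<Rightarrow>\<^sub>L 'h) \<Rightarrow> ('h \<Rightarrow>\<^sub>L 'h)" where
  "op_inverse T = (THE S. S \<in> bounded_ops \<and> S o\<^sub>L T = id_blinfun \<and> T o\<^sub>L S = id_blinfun)"

definition orthogonal_projection :: "'h::complex_hilbert set \<Rightarrow> ('h \<Rightarrow>\<^sub>L 'h)" where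
  "orthogonal_projection M = (THE P. 
     \<forall>x. blinfun_apply P x \<in> M \<and> (\<forall>y\<in>M. cinner y (x - blinfun_apply P x) = 0))"

definition basis_projection :: "(int \<Rightarrow> 'h::complex_hilbert) \<Rightarrow> nat \<Rightarrow> ('h \<Rightarrow>\<^sub>L 'h)" where
  "basis_projection e m = orthogonal_projection (complex_vector.span (e ` {- int m..int m}))"

text \<open>The composition \<open>A (n - 1) \<cdots> A 1 A 0\<close>.\<close>

primrec op_prod :: "(nat \<Rightarrow> 'h::complex_hilbert \<Rightarrow>\<^sub>L 'h) \<Rightarrow> nat \<Rightarrow> ('h \<Rightarrow>\<^sub>L 'h)" where
  "op_prod A 0 = id_blinfun"
| "op_prod A (Suc n) = A n o\<^sub>L op_prod A n"

text \<open>
  The standard Hilbert module over the compact operators. Convergence over the index set is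
  unconditional convergence in norm; as the summands \<open>x\<^sub>j\<^sup>*x\<^sub>j\<close> are positive, this is the same as
  convergence of the sums over \<open>{-n..n}\<close>.
\<close>

definition ell2 :: "(int \<Rightarrow> 'h::complex_hilbert \<Rightarrow>\<^sub>L 'h) set" where
  "ell2 = {x. (\<forall>j. x j \<in> compact_ops) \<and> (\<lambda>j. op_adjoint (x j) o\<^sub>L x j) summable_on UNIV}"

definition ell2_inner ::
    "(int \<Rightarrow> 'h::complex_hilbert \<Rightarrow>\<^sub>L 'h) \<Rightarrow> (int \<Rightarrow> 'h \<Rightarrow>\<^sub>L 'h) \<Rightarrow> ('h \<Rightarrow>\<^sub>L 'h)" where
  "ell2_inner x y = (\<Sum>\<^sub>\<infinity>j\<in>UNIV. op_adjoint (x j) o\<^sub>L y j)"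

definition ell2_norm :: "(int \<Rightarrow> 'h::complex_hilbert \<Rightarrow>\<^sub>L 'h) \<Rightarrow> real" where
  "ell2_norm x = sqrt (norm (ell2_inner x x))"

definition weighted_shift ::
    "('h::complex_hilbert \<Rightarrow>\<^sub>L 'h) \<Rightarrow> (int \<Rightarrow> 'h \<Rightarrow>\<^sub>L 'h) \<Rightarrow>
     (int \<Rightarrow> 'h \<Rightarrow>\<^sub>L 'h) \<Rightarrow> (int \<Rightarrow> 'h \<Rightarrow>\<^sub>L 'h)" where
  "weighted_shift U W x = (\<lambda>\<xi>. W \<xi> o\<^sub>L x (\<xi> - 1) o\<^sub>L U)"

text \<open>
  Density and hypercyclicity in the normed space with carrier \<open>X\<close> and norm \<open>N\<close>.
\<close>

definition norm_dense :: "'x::minus set \<Rightarrow> ('x \<Rightarrow> real) \<Rightarrow> 'x set \<Rightarrow> bool" where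
  "norm_dense X N S \<longleftrightarrow> S \<subseteq> X \<and> (\<forall>x\<in>X. \<forall>\<epsilon>>0. \<exists>y\<in>S. N (y - x) < \<epsilon>)"

definition densely_hypercyclic :: "'x::minus set \<Rightarrow> ('x \<Rightarrow> real) \<Rightarrow> (nat \<Rightarrow> 'x \<Rightarrow> 'x) \<Rightarrow> bool" where
  "densely_hypercyclic X N T \<longleftrightarrow>
     norm_dense X N {x \<in> X. norm_dense X N (range (\<lambda>n. T n x))}"

end

theory Submission
  imports Defs
begin

text \<open>
  Birkhoff's argument. The module \<open>ell2\<close> is complete and separable, so by the Baire category theorem
  it suffices, for the direction from (2), to move any given ball into any given ball by some power
  of the shift \<open>T\<close>. After approximation the centres \<open>x\<close>, \<open>y\<close> are finitely supported with \<open>P\<^sub>m x\<^sub>j = x\<^sub>j\<close>,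
  \<open>P\<^sub>m y\<^sub>j = y\<^sub>j\<close>, and \<open>u = D x + T\<^sup>-\<^sup>t (G y)\<close> is close to \<open>x\<close> while \<open>T\<^sup>t u\<close> is close to \<open>y\<close>. Conversely, if \<open>y\<close>
  and \<open>T\<^sup>t y\<close> are both close to the sequence with entries \<open>P\<^sub>m\<close> on \<open>[J]\<close> and \<open>t > 2J\<close>, then
  \<open>D\<^sub>j = y\<^sub>j\<close> and \<open>G\<^sub>j = (T\<^sup>t y)\<^sub>j\<close> are as in (2), because the shifted entries lie outside \<open>[J]\<close>.

  The norm of \<open>ell2\<close> is handled as that of the column operator \<open>h \<mapsto> (x\<^sub>j h)\<^sub>j\<close>.
\<close>

subsection \<open>Hilbert space preliminaries\<close>

text \<open>Compactness enters through \<open>P_m T -> T\<close> in norm, which holds for compact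
  \<open>T\<close>. This gives the separability that the Baire argument uses, and it permits the
  assumption \<open>P_m x_j = x_j\<close>, under which \<open>D x_j - x_j = (D - P_m) x_j\<close> is
  small. The weight products act to the left of \<open>D\<close>, so applied to \<open>D x_j\<close>
  they give norm at most that of (product) \<open>D\<close> times \<open>norm x_j\<close>. The
  unitary multiplies from the right and drops out of every norm, which is why (2) does not mention
  it. In the converse the difficulty is \<open>t > 2J\<close>: the target could itself be an early
  point of the orbit, and then closeness alone says nothing about the exponent. So the orbit is sent
  to a slightly rescaled target that none of the finitely many early points equals. The column
  operator turns estimates in the module into estimates for one vector \<open>h\<close> and one
  finite index set at a time. The triangle inequality, the bound for shifts and the passage to
  limits then become facts about finite l2 sums of norms, without an order relation on
  operators.\<close>

lemma cinner_add_left: "cinner (x + y) z = cinner x z + cinner y (z::'h::complex_hilbert)"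
  by (metis cinner_add_right cinner_commute complex_cnj_add)

lemma cinner_scaleC_left: "cinner (c *\<^sub>C x) (y::'h::complex_hilbert) = cnj c * cinner x y"
  by (metis cinner_commute cinner_scaleC_right complex_cnj_mult)

lemma cinner_zero [simp]: "cinner (x::'h::complex_hilbert) 0 = 0" "cinner 0 (x::'h::complex_hilbert) = 0"
  using cinner_add_right[of x 0 0] cinner_add_left[of 0 0 x] by simp_all

lemma cinner_minus_right: "cinner (x::'h::complex_hilbert) (- y) = - cinner x y"
  using cinner_add_right[of x y "- y"] by (simp add: add_eq_0_iff)

lemma cinner_diff_right: "cinner (x::'h::complex_hilbert) (y - z) = cinner x y - cinner x z"
  using cinner_add_right[of x y "- z"] by (simp add: cinner_minus_right)

lemma cinner_diff_left: "cinner (x - y) (z::'h::complex_hilbert) = cinner x z - cinner y z"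
  by (metis cinner_commute cinner_diff_right complex_cnj_diff)

lemma cinner_scaleR_right: "cinner (x::'h::complex_hilbert) (r *\<^sub>R y) = of_real r * cinner x y"
  by (simp add: scaleR_scaleC cinner_scaleC_right)

lemma cinner_scaleR_left: "cinner (r *\<^sub>R x) (y::'h::complex_hilbert) = of_real r * cinner x y"
  by (simp add: scaleR_scaleC cinner_scaleC_left)

lemma cinner_sum_right: "cinner (x::'h::complex_hilbert) (sum f A) = (\<Sum>a\<in>A. cinner x (f a))"
  by (induction A rule: infinite_finite_induct) (simp_all add: cinner_add_right)

lemma power2_norm_eq_cinner: "(norm (x::'h::complex_hilbert))\<^sup>2 = Re (cinner x x)"
  by (simp add: norm_eq_sqrt_cinner cinner_ge_zero)

lemma cinner_self: "cinner x x = of_real ((norm (x::'h::complex_hilbert))\<^sup>2)"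
proof (rule complex_eqI)
  show "Im (cinner x x) = Im (of_real ((norm x)\<^sup>2))"
    using cinner_commute[of x x] by (simp add: complex_eq_iff)
qed (simp add: power2_norm_eq_cinner)

lemma norm_scaleC: "norm (c *\<^sub>C (x::'h::complex_hilbert)) = cmod c * norm x"
proof (rule power2_eq_imp_eq)
  have "cinner (c *\<^sub>C x) (c *\<^sub>C x) = (c * cnj c) * cinner x x"
    by (simp add: cinner_scaleC_left cinner_scaleC_right)
  also have "\<dots> = of_real ((cmod c * norm x)\<^sup>2)"
    by (simp add: complex_norm_square[symmetric] cinner_self power_mult_distrib)
  finally show "(norm (c *\<^sub>C x))\<^sup>2 = (cmod c * norm x)\<^sup>2"
    by (simp add: power2_norm_eq_cinner)
qed auto

text \<open>The class inherits the triangle inequality from \<open>banach\<close>, so the real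
  Cauchy-Schwarz inequality follows by comparing the expansion of the squared norm of
  \<open>x + y\<close> with the square of \<open>norm x + norm y\<close>.\<close>

lemma Re_cinner_le_norm: "Re (cinner x y) \<le> norm x * norm (y::'h::complex_hilbert)"
proof -
  have "(norm (x + y))\<^sup>2 = (norm x)\<^sup>2 + (norm y)\<^sup>2 + Re (cinner x y) + Re (cinner y x)"
    by (simp add: power2_norm_eq_cinner cinner_add_right cinner_add_left)
  moreover have "Re (cinner y x) = Re (cinner x y)"
    by (subst cinner_commute) simp
  moreover have "(norm (x + y))\<^sup>2 \<le> (norm x + norm y)\<^sup>2"
    by (intro power_mono norm_triangle_ineq norm_ge_zero)
  ultimately show ?thesis
    by (simp add: power2_sum)
qed

lemma norm_cinner_le: "cmod (cinner x y) \<le> norm x * norm (y::'h::complex_hilbert)"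
proof (cases "cinner x y = 0")
  case False
  \<comment> \<open>A unimodular factor that rotates \<open>cinner x y\<close> onto its modulus, so
    that the bound for real parts applies.\<close>
  define u where "u = cnj (sgn (cinner x y))"
  have "cmod u = 1"
    using False by (simp add: u_def norm_sgn)
  have "cinner x (u *\<^sub>C y) = of_real (cmod (cinner x y))"
    using False by (simp add: u_def cinner_scaleC_right sgn_eq scaleR_conv_of_real complex_norm_square[symmetric] power2_eq_square field_simps)
  then have "cmod (cinner x y) = Re (cinner x (u *\<^sub>C y))"
    by simp
  also have "\<dots> \<le> norm x * norm (u *\<^sub>C y)"
    by (rule Re_cinner_le_norm)
  finally show ?thesis
    by (simp add: norm_scaleC \<open>cmod u = 1\<close>)
qed auto

lemma bounded_linear_cinner: "bounded_linear (\<lambda>y. cinner (x::'h::complex_hilbert) y)"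
  by (rule bounded_linear_intro[where K = "norm x"])
    (simp_all add: cinner_add_right cinner_scaleR_right scaleR_conv_of_real
      norm_cinner_le[of x, unfolded mult.commute[of "norm x"]])

lemma bounded_linear_scaleC_left: "bounded_linear (\<lambda>c. c *\<^sub>C (x::'h::complex_hilbert))"
  by (rule bounded_linear_intro[where K = "norm x"])
    (simp_all add: scaleC_add_left norm_scaleC scaleC_scaleC scaleR_scaleC scaleR_conv_of_real)

lemma bounded_linear_scaleC_right: "bounded_linear (\<lambda>x. c *\<^sub>C (x::'h::complex_hilbert))"
  by (rule bounded_linear_intro[where K = "cmod c"])
    (simp_all add: scaleC_add_right norm_scaleC scaleC_scaleC scaleR_scaleC mult.commute)

lemma cinner_eqI:
  fixes x y :: "'h::complex_hilbert"
  assumes "\<And>z. cinner x z = cinner y z"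
  shows "x = y"
proof -
  have "(norm (x - y))\<^sup>2 = 0"
    by (simp add: power2_norm_eq_cinner cinner_diff_left assms)
  then show ?thesis by simp
qed

text \<open>The representing vector is the minimiser of \<open>\<parallel>x\<parallel>\<^sup>2 - 2 Re (f x)\<close>, which exists because
  minimising sequences are Cauchy by the parallelogram law.\<close>

lemma riesz_representation:
  fixes f :: "'h::complex_hilbert \<Rightarrow> complex"
  assumes f: "bounded_linear f" and fC: "\<And>c x. f (c *\<^sub>C x) = c * f x"
  shows "\<exists>z. \<forall>x. f x = cinner z x"
proof -
  define F where "F x = (norm x)\<^sup>2 - 2 * Re (f x)" for x
  obtain K where K: "\<And>x. norm (f x) \<le> norm x * K"
    using bounded_linear.bounded[OF f] by blast
  have lin: "f (x + y) = f x + f y" "f (r *\<^sub>R x) = of_real r * f x" for x y r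
    using linear_simps[OF f] by (simp_all add: scaleR_conv_of_real)
  have lower: "- K\<^sup>2 \<le> F x" for x
  proof -
    have "Re (f x) \<le> norm x * K"
      using K[of x] complex_Re_le_cmod[of "f x"] by linarith
    moreover have "0 \<le> (norm x - K)\<^sup>2" by simp
    ultimately show ?thesis
      by (simp add: F_def power2_diff)
  qed
  define m where "m = Inf (range F)"
  have bdd: "bdd_below (range F)"
    using lower by (auto simp: bdd_below_def)
  have m: "m \<le> F x" for x
    unfolding m_def by (rule cInf_lower[OF _ bdd]) simp
  have "\<exists>x. F x < m + inverse (of_nat (Suc n))" for n :: nat
    using cInf_lessD[of "range F" "m + inverse (of_nat (Suc n))"] by (auto simp: m_def)
  then obtain X where X: "\<And>n::nat. F (X n) < m + inverse (of_nat (Suc n))"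
    by metis
  \<comment> \<open>The parallelogram law for \<open>F\<close>: the linear terms cancel. As the
    midpoint has value at least \<open>m\<close>, two almost minimal points are close to each
    other.\<close>
  have par: "(norm (x - y))\<^sup>2 = 2 * F x + 2 * F y - 4 * F ((1/2) *\<^sub>R (x + y))" for x y
  proof -
    have "(norm (x - y))\<^sup>2 + (norm (x + y))\<^sup>2 = 2 * (norm x)\<^sup>2 + 2 * (norm y)\<^sup>2"
      by (simp add: power2_norm_eq_cinner cinner_diff_left cinner_diff_right
          cinner_add_right cinner_add_left)
    moreover have "(norm ((1/2) *\<^sub>R (x + y)))\<^sup>2 = (norm (x + y))\<^sup>2 / 4"
      by (simp add: power_divide)
    moreover have "Re (f ((1/2) *\<^sub>R (x + y))) = (Re (f x) + Re (f y)) / 2"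
      by (simp only: lin) (simp add: field_simps)
    ultimately show ?thesis
      by (simp add: F_def field_simps)
  qed
  have "Cauchy X"
  proof (rule metric_CauchyI)
    fix \<epsilon> :: real assume "\<epsilon> > 0"
    \<comment> \<open>Values below \<open>m + \<epsilon>^2 / 4\<close> suffice: by
      \<open>par\<close> the squared distance is then below
      \<open>4 (m + \<epsilon>^2 / 4) - 4 m = \<epsilon>^2\<close>.\<close>
    then obtain N :: nat where N: "inverse (of_nat (Suc N)) < \<epsilon>\<^sup>2 / 4"
      using reals_Archimedean[of "\<epsilon>\<^sup>2 / 4"] by auto
    have "dist (X i) (X j) < \<epsilon>" if "i \<ge> N" "j \<ge> N" for i j
    proof -
      have le: "inverse (of_nat (Suc k)) \<le> inverse (of_nat (Suc N) :: real)" if "k \<ge> N" for k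
        using that by (simp add: field_simps)
      then have "F (X i) < m + \<epsilon>\<^sup>2 / 4" "F (X j) < m + \<epsilon>\<^sup>2 / 4"
        using X[of i] X[of j] N that le[of i] le[of j] by linarith+
      then have "(norm (X i - X j))\<^sup>2 < \<epsilon>\<^sup>2"
        using par[of "X i" "X j"] m[of "(1/2) *\<^sub>R (X i + X j)"] by linarith
      then show ?thesis
        using \<open>\<epsilon> > 0\<close> by (simp add: dist_norm power_less_imp_less_base)
    qed
    then show "\<exists>N. \<forall>i\<ge>N. \<forall>j\<ge>N. dist (X i) (X j) < \<epsilon>" by blast
  qed
  then obtain z where z: "X \<longlonglongrightarrow> z"
    by (auto simp: Cauchy_convergent_iff convergent_def)
  have "(\<lambda>n. F (X n)) \<longlonglongrightarrow> F z"
    unfolding F_def by (intro tendsto_intros bounded_linear.tendsto[OF f] z)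
  moreover have "(\<lambda>n. m + inverse (of_nat (Suc n))) \<longlonglongrightarrow> m + 0"
    by (intro tendsto_intros LIMSEQ_inverse_real_of_nat)
  ultimately have "F z \<le> m + 0"
    by (rule LIMSEQ_le) (use X in \<open>auto intro: less_imp_le\<close>)
  then have min: "F z \<le> F x" for x
    using m[of x] by simp
  have ReI: "Re (f y) = Re (cinner z y)" for y
  proof (rule ccontr)
    define a where "a = Re (cinner z y) - Re (f y)"
    assume "Re (f y) \<noteq> Re (cinner z y)"
    then have "a \<noteq> 0" by (simp add: a_def)
    have expand: "F (z + r *\<^sub>R y) = F z + 2 * r * a + r\<^sup>2 * (norm y)\<^sup>2" for r
    proof -
      have "Re (cinner y z) = Re (cinner z y)"
        by (subst cinner_commute) simp
      then have "(norm (z + r *\<^sub>R y))\<^sup>2 = (norm z)\<^sup>2 + 2 * r * Re (cinner z y) + r * (r * (norm y)\<^sup>2)"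
        by (simp add: power2_norm_eq_cinner cinner_add_right cinner_add_left
            cinner_scaleR_left cinner_scaleR_right distrib_left)
      then show ?thesis
        unfolding F_def by (simp add: lin a_def algebra_simps power2_eq_square[of r])
    qed
    have "y \<noteq> 0"
      using \<open>a \<noteq> 0\<close> linear_simps(3)[OF f] by (auto simp: a_def)
    \<comment> \<open>The minimiser of the quadratic \<open>2 r a + r^2 (norm y)^2\<close>, which is
      negative there because \<open>a\<close> is nonzero.\<close>
    define r where "r = - a / (norm y)\<^sup>2"
    have "2 * r * a + r\<^sup>2 * (norm y)\<^sup>2 = - (a\<^sup>2 / (norm y)\<^sup>2)"
      using \<open>y \<noteq> 0\<close> by (simp add: r_def field_simps power2_eq_square)
    moreover have "a\<^sup>2 / (norm y)\<^sup>2 > 0"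
      using \<open>a \<noteq> 0\<close> \<open>y \<noteq> 0\<close> by simp
    ultimately show False
      using min[of "z + r *\<^sub>R y"] expand[of r] by linarith
  qed
  have "f y = cinner z y" for y
  proof (rule complex_eqI)
    \<comment> \<open>Multiplying the argument by \<open>\<i>\<close> turns minus the imaginary part
      into a real part.\<close>
    show "Im (f y) = Im (cinner z y)"
      using ReI[of "\<i> *\<^sub>C y"] by (simp add: fC cinner_scaleC_right)
  qed (rule ReI)
  then show ?thesis by blast
qed

section \<open>Adjoints and unitary operators\<close>

lemma bounded_opsD: "T \<in> bounded_ops \<Longrightarrow> blinfun_apply T (c *\<^sub>C x) = c *\<^sub>C blinfun_apply T x"
  by (simp add: bounded_ops_def)

lemma ex_adjoint:
  fixes T :: "'h::complex_hilbert \<Rightarrow>\<^sub>L 'h"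
  assumes T: "T \<in> bounded_ops"
  shows "\<exists>S. \<forall>x y. cinner (blinfun_apply S x) y = cinner x (blinfun_apply T y)"
proof -
  have "\<exists>z. \<forall>y. cinner x (T y) = cinner z y" for x
    using riesz_representation[of "\<lambda>y. cinner x (T y)"]
    by (auto intro: bounded_linear_compose[OF bounded_linear_cinner] blinfun.bounded_linear_right
        simp: bounded_opsD[OF T] cinner_scaleC_right)
  then obtain s where s: "\<And>x y. cinner x (T y) = cinner (s x) y"
    by metis
  have "bounded_linear s"
  proof (rule bounded_linear_intro[where K = "norm T"])
    show "s (x + y) = s x + s y" for x y
      by (rule cinner_eqI) (simp add: s[symmetric] cinner_add_left)
    show "s (r *\<^sub>R x) = r *\<^sub>R s x" for r x
      by (rule cinner_eqI) (simp add: s[symmetric] cinner_scaleR_left)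
    show "norm (s x) \<le> norm x * norm T" for x
    proof (cases "s x = 0")
      case False
      have "(norm (s x))\<^sup>2 = Re (cinner x (T (s x)))"
        by (simp add: power2_norm_eq_cinner s)
      also have "\<dots> \<le> norm x * norm (T (s x))"
        by (rule Re_cinner_le_norm)
      also have "\<dots> \<le> norm x * (norm T * norm (s x))"
        by (intro mult_left_mono norm_blinfun) simp
      finally show ?thesis
        using False by (simp add: power2_eq_square)
    qed auto
  qed
  then show ?thesis
    by (intro exI[of _ "Blinfun s"]) (simp add: bounded_linear_Blinfun_apply s)
qed

lemma op_adjoint:
  fixes T :: "'h::complex_hilbert \<Rightarrow>\<^sub>L 'h"
  assumes T: "T \<in> bounded_ops"
  shows "cinner (blinfun_apply (op_adjoint T) x) y = cinner x (blinfun_apply T y)"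
proof -
  have "\<exists>!S. \<forall>x y. cinner (blinfun_apply S x) y = cinner x (blinfun_apply T y)"
  proof (rule ex_ex1I[OF ex_adjoint[OF T]])
    fix S S' :: "'h \<Rightarrow>\<^sub>L 'h"
    assume "\<forall>x y. cinner (S x) y = cinner x (T y)" "\<forall>x y. cinner (S' x) y = cinner x (T y)"
    then show "S = S'"
      by (intro blinfun_eqI cinner_eqI) simp
  qed
  from theI'[OF this] show ?thesis
    unfolding op_adjoint_def by blast
qed

lemma op_adjoint_bounded_ops:
  fixes T :: "'h::complex_hilbert \<Rightarrow>\<^sub>L 'h"
  assumes T: "T \<in> bounded_ops"
  shows "op_adjoint T \<in> bounded_ops"
proof -
  have "op_adjoint T (c *\<^sub>C x) = c *\<^sub>C op_adjoint T x" for c x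
    by (rule cinner_eqI) (simp add: op_adjoint[OF T] cinner_scaleC_left)
  then show ?thesis by (simp add: bounded_ops_def)
qed

lemma cinner_op_adjoint_right:
  fixes T :: "'h::complex_hilbert \<Rightarrow>\<^sub>L 'h"
  assumes T: "T \<in> bounded_ops"
  shows "cinner x (blinfun_apply (op_adjoint T) y) = cinner (blinfun_apply T x) y"
  by (metis T cinner_commute op_adjoint)

lemma unitary_op_norm:
  assumes "unitary_op U"
  shows "norm (blinfun_apply U h) = norm h"
proof (rule power2_eq_imp_eq)
  have U: "U \<in> bounded_ops" "op_adjoint U o\<^sub>L U = id_blinfun"
    using assms by (auto simp: unitary_op_def)
  have "op_adjoint U (U h) = h"
    using arg_cong[OF U(2), of "\<lambda>T. blinfun_apply T h"] by simp
  then show "(norm (U h))\<^sup>2 = (norm h)\<^sup>2"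
    using op_adjoint[OF U(1), of "U h" h] by (simp add: power2_norm_eq_cinner)
qed auto

lemma unitary_op_adjoint_norm:
  assumes "unitary_op U"
  shows "norm (blinfun_apply (op_adjoint U) h) = norm h"
proof -
  have U: "U o\<^sub>L op_adjoint U = id_blinfun"
    using assms by (simp add: unitary_op_def)
  have "U (op_adjoint U h) = h"
    using arg_cong[OF U, of "\<lambda>T. blinfun_apply T h"] by simp
  then show ?thesis
    using unitary_op_norm[OF assms, of "op_adjoint U h"] by simp
qed

subsection \<open>Compact operators\<close>

lemma bounded_ops_zero: "0 \<in> bounded_ops"
  by (simp add: bounded_ops_def)

lemma bounded_ops_id: "id_blinfun \<in> bounded_ops"
  by (simp add: bounded_ops_def)

lemma bounded_ops_add: "S \<in> bounded_ops \<Longrightarrow> T \<in> bounded_ops \<Longrightarrow> S + T \<in> bounded_ops"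
  by (simp add: bounded_ops_def blinfun.add_left scaleC_add_right)

lemma bounded_ops_compose: "S \<in> bounded_ops \<Longrightarrow> T \<in> bounded_ops \<Longrightarrow> S o\<^sub>L T \<in> bounded_ops"
  by (simp add: bounded_ops_def)

lemma bounded_ops_scaleR: "T \<in> bounded_ops \<Longrightarrow> r *\<^sub>R T \<in> bounded_ops"
  by (simp add: bounded_ops_def blinfun.scaleR_left scaleR_scaleC scaleC_scaleC mult.commute)

lemma bounded_ops_lim:
  assumes lim: "f \<longlonglongrightarrow> T" and f: "\<And>n. f n \<in> bounded_ops"
  shows "T \<in> bounded_ops"
proof -
  have "T (c *\<^sub>C x) = c *\<^sub>C T x" for c x
  proof (rule LIMSEQ_unique)
    show "(\<lambda>n. f n (c *\<^sub>C x)) \<longlonglongrightarrow> T (c *\<^sub>C x)"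
      by (intro blinfun.tendsto lim tendsto_const)
    have "(\<lambda>n. c *\<^sub>C f n x) \<longlonglongrightarrow> c *\<^sub>C T x"
      by (intro bounded_linear.tendsto[OF bounded_linear_scaleC_right] blinfun.tendsto lim tendsto_const)
    then show "(\<lambda>n. f n (c *\<^sub>C x)) \<longlonglongrightarrow> c *\<^sub>C T x"
      by (simp add: bounded_opsD[OF f])
  qed
  then show ?thesis by (simp add: bounded_ops_def)
qed

lemma compact_opsI:
  assumes "T \<in> bounded_ops" "compact K" "blinfun_apply T ` cball 0 1 \<subseteq> K"
  shows "T \<in> compact_ops"
proof -
  have "closure (blinfun_apply T ` cball 0 1) \<subseteq> K"
    using assms by (simp add: closure_minimal compact_imp_closed)
  then have "compact (closure (blinfun_apply T ` cball 0 1))"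
    using \<open>compact K\<close> compact_Int_closed[of K "closure (blinfun_apply T ` cball 0 1)"]
    by (simp add: Int_absorb1)
  then show ?thesis
    using assms by (simp add: compact_ops_def)
qed

lemma compact_ops_bounded: "T \<in> compact_ops \<Longrightarrow> T \<in> bounded_ops"
  by (simp add: compact_ops_def)

lemma compact_ops_compact: "T \<in> compact_ops \<Longrightarrow> compact (closure (blinfun_apply T ` cball 0 1))"
  by (simp add: compact_ops_def)

lemma compact_ops_zero: "0 \<in> compact_ops"
  by (rule compact_opsI[of _ "{0}"]) (auto simp: bounded_ops_zero)

lemma compact_ops_add:
  assumes "S \<in> compact_ops" "T \<in> compact_ops"
  shows "S + T \<in> compact_ops"
proof (rule compact_opsI)
  show "compact {x + y | x y. x \<in> closure (blinfun_apply S ` cball 0 1) \<and> y \<in> closure (blinfun_apply T ` cball 0 1)}"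
    by (intro compact_sums compact_ops_compact assms)
  show "blinfun_apply (S + T) ` cball 0 1 \<subseteq>
      {x + y | x y. x \<in> closure (blinfun_apply S ` cball 0 1) \<and> y \<in> closure (blinfun_apply T ` cball 0 1)}"
    by (auto simp: blinfun.add_left intro!: exI subsetD[OF closure_subset] image_eqI)
qed (simp add: assms bounded_ops_add compact_ops_bounded)

lemma compact_ops_compose_left:
  assumes "A \<in> bounded_ops" "T \<in> compact_ops"
  shows "A o\<^sub>L T \<in> compact_ops"
proof (rule compact_opsI)
  show "compact (blinfun_apply A ` closure (blinfun_apply T ` cball 0 1))"
    by (intro compact_continuous_image linear_continuous_on blinfun.bounded_linear_right compact_ops_compact assms)
  show "blinfun_apply (A o\<^sub>L T) ` cball 0 1 \<subseteq> blinfun_apply A ` closure (blinfun_apply T ` cball 0 1)"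
    using closure_subset by fastforce
qed (simp add: assms bounded_ops_compose compact_ops_bounded)

lemma compact_ops_compose_right:
  assumes "A \<in> bounded_ops" "T \<in> compact_ops"
  shows "T o\<^sub>L A \<in> compact_ops"
proof (rule compact_opsI)
  show "compact ((\<lambda>x. norm A *\<^sub>R x) ` closure (blinfun_apply T ` cball 0 1))"
    by (intro compact_scaling compact_ops_compact assms)
  show "blinfun_apply (T o\<^sub>L A) ` cball 0 1 \<subseteq> (\<lambda>x. norm A *\<^sub>R x) ` closure (blinfun_apply T ` cball 0 1)"
  proof (rule image_subsetI)
    fix x :: 'a assume x: "x \<in> cball 0 1"
    have "norm (A x) \<le> norm A"
      using norm_blinfun[of A x] x mult_left_mono[of "norm x" 1 "norm A"] by simp
    \<comment> \<open>If \<open>norm A = 0\<close>, then \<open>A x = 0\<close> and division by zero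
      also returns 0, so both claims survive this case.\<close>
    then have "A x = norm A *\<^sub>R (A x /\<^sub>R norm A)" "A x /\<^sub>R norm A \<in> cball 0 1"
      by (cases "norm A = 0"; simp add: divide_le_eq_1 flip: divide_inverse_commute)+
    then have "T (A x) = norm A *\<^sub>R T (A x /\<^sub>R norm A)" "T (A x /\<^sub>R norm A) \<in> closure (blinfun_apply T ` cball 0 1)"
      by (metis blinfun.scaleR_right) (meson \<open>A x /\<^sub>R norm A \<in> cball 0 1\<close> closure_subset image_eqI subsetD)
    then show "blinfun_apply (T o\<^sub>L A) x \<in> (\<lambda>x. norm A *\<^sub>R x) ` closure (blinfun_apply T ` cball 0 1)"
      by (simp only: blinfun_apply_blinfun_compose image_eqI)
  qed
qed (simp add: assms bounded_ops_compose compact_ops_bounded)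

lemma compact_ops_scaleR:
  assumes "T \<in> compact_ops"
  shows "r *\<^sub>R T \<in> compact_ops"
proof -
  have "(r *\<^sub>R id_blinfun) o\<^sub>L T = r *\<^sub>R T"
    by (rule blinfun_eqI) (simp add: blinfun.scaleR_left)
  then show ?thesis
    by (metis assms bounded_ops_id bounded_ops_scaleR compact_ops_compose_left)
qed

lemma compact_ops_sum: "(\<And>a. a \<in> A \<Longrightarrow> f a \<in> compact_ops) \<Longrightarrow> sum f A \<in> compact_ops"
  by (induction A rule: infinite_finite_induct) (auto simp: compact_ops_zero compact_ops_add)

lemma compact_ops_totally_bounded:
  assumes "T \<in> compact_ops" "\<epsilon> > 0"
  obtains F where "finite F" "\<And>h. norm h \<le> 1 \<Longrightarrow> \<exists>x\<in>F. norm (blinfun_apply T h - x) < \<epsilon>"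
proof -
  obtain F where F: "finite F" "closure (blinfun_apply T ` cball 0 1) \<subseteq> (\<Union>x\<in>F. ball x \<epsilon>)"
    using compact_ops_compact[OF assms(1)] assms(2) unfolding compact_eq_totally_bounded by blast
  have "\<exists>x\<in>F. norm (blinfun_apply T h - x) < \<epsilon>" if "norm h \<le> 1" for h
  proof -
    have "T h \<in> closure (blinfun_apply T ` cball 0 1)"
      using that by (intro subsetD[OF closure_subset]) auto
    then obtain x where "x \<in> F" "dist x (T h) < \<epsilon>"
      using F(2) by fastforce
    then show ?thesis
      by (metis dist_commute dist_norm)
  qed
  with F(1) show ?thesis
    using that by blast
qed

lemma norm_blinfun_le_on_ball: "norm h \<le> 1 \<Longrightarrow> norm (blinfun_apply T h) \<le> norm T"
  using norm_blinfun[of T h] mult_left_mono[of "norm h" 1 "norm T"] by simp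

lemma compact_ops_lim:
  assumes lim: "f \<longlonglongrightarrow> T" and f: "\<And>n. f n \<in> compact_ops"
  shows "T \<in> compact_ops"
proof -
  have T: "T \<in> bounded_ops"
    by (rule bounded_ops_lim[OF lim]) (simp add: f compact_ops_bounded)
  have "\<exists>k. finite k \<and> closure (blinfun_apply T ` cball 0 1) \<subseteq> (\<Union>x\<in>k. ball x \<epsilon>)" if "\<epsilon> > 0" for \<epsilon>
  proof -
    obtain n where n: "norm (f n - T) < \<epsilon> / 4"
      using lim \<open>\<epsilon> > 0\<close> LIMSEQ_D[OF lim, of "\<epsilon>/4"] by auto
    have "\<epsilon> / 4 > 0" using \<open>\<epsilon> > 0\<close> by simp
    from compact_ops_totally_bounded[OF f[of n] this]
    obtain F where F: "finite F" "\<And>h. norm h \<le> 1 \<Longrightarrow> \<exists>x\<in>F. norm (f n h - x) < \<epsilon> / 4"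
      by blast
    \<comment> \<open>Closed balls, so that the finite cover also contains the closure; they are
      then enlarged to open balls of radius \<open>\<epsilon>\<close>.\<close>
    have "blinfun_apply T ` cball 0 1 \<subseteq> (\<Union>x\<in>F. cball x (\<epsilon>/2))"
    proof (rule image_subsetI)
      fix h :: 'a assume h: "h \<in> cball 0 1"
      then obtain x where x: "x \<in> F" "norm (f n h - x) < \<epsilon> / 4"
        using F(2)[of h] by auto
      have "norm (T h - x) \<le> norm (f n h - x) + norm ((f n - T) h)"
        by (simp add: blinfun.diff_left norm_triangle_sub)
          (metis add_diff_eq diff_add_cancel norm_minus_commute norm_triangle_ineq diff_diff_eq2 add.commute)
      moreover have "norm ((f n - T) h) \<le> norm (f n - T)"
        using h by (intro norm_blinfun_le_on_ball) simp
      ultimately have "norm (T h - x) \<le> \<epsilon> / 2"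
        using x n by linarith
      then show "T h \<in> (\<Union>x\<in>F. cball x (\<epsilon>/2))"
        using x(1) by (auto simp: dist_norm norm_minus_commute)
    qed
    moreover have "closed (\<Union>x\<in>F. cball x (\<epsilon>/2))"
      using F(1) by (intro closed_UN) auto
    ultimately have "closure (blinfun_apply T ` cball 0 1) \<subseteq> (\<Union>x\<in>F. cball x (\<epsilon>/2))"
      by (rule closure_minimal)
    also have "\<dots> \<subseteq> (\<Union>x\<in>F. ball x \<epsilon>)"
      using \<open>\<epsilon> > 0\<close> by fastforce
    finally show ?thesis
      using F(1) by blast
  qed
  then have "compact (closure (blinfun_apply T ` cball 0 1))"
    unfolding compact_eq_totally_bounded by (simp add: complete_eq_closed)
  then show ?thesis
    using T by (simp add: compact_ops_def)
qed

section \<open>Finite-rank approximation, basis projections and separability\<close>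

definition rank_one :: "'h::complex_hilbert \<Rightarrow> 'h \<Rightarrow> 'h \<Rightarrow>\<^sub>L 'h" where
  "rank_one a v = Blinfun (\<lambda>h. cinner v h *\<^sub>C a)"

lemma rank_one_apply [simp]: "blinfun_apply (rank_one a v) h = cinner v h *\<^sub>C a"
  unfolding rank_one_def
  by (subst bounded_linear_Blinfun_apply)
    (auto intro: bounded_linear_compose[OF bounded_linear_scaleC_left bounded_linear_cinner])

lemma norm_rank_one_le: "norm (rank_one a v) \<le> norm a * norm v"
proof (rule norm_blinfun_bound)
  fix h
  have "cmod (cinner v h) * norm a \<le> (norm v * norm h) * norm a"
    by (intro mult_right_mono norm_cinner_le) simp
  then show "norm (rank_one a v h) \<le> norm a * norm v * norm h"
    by (simp add: norm_scaleC mult_ac)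
qed simp

lemma rank_one_diff: "rank_one a v - rank_one a w = rank_one a (v - w)"
  by (rule blinfun_eqI) (simp add: blinfun.diff_left cinner_diff_left complex_vector.scale_left_diff_distrib)

lemma rank_one_compact: "rank_one a v \<in> compact_ops"
proof (rule compact_opsI)
  show "rank_one a v \<in> bounded_ops"
    by (simp add: bounded_ops_def cinner_scaleC_right scaleC_scaleC)
  show "compact ((\<lambda>c. c *\<^sub>C a) ` cball 0 (norm v))"
    by (intro compact_continuous_image linear_continuous_on bounded_linear_scaleC_left) simp
  show "blinfun_apply (rank_one a v) ` cball 0 1 \<subseteq> (\<lambda>c. c *\<^sub>C a) ` cball 0 (norm v)"
  proof (rule image_subsetI)
    fix h :: 'a assume "h \<in> cball 0 1"
    then have "cmod (cinner v h) \<le> norm v"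
      using norm_cinner_le[of v h] mult_left_mono[of "norm h" 1 "norm v"] by simp
    then show "rank_one a v h \<in> (\<lambda>c. c *\<^sub>C a) ` cball 0 (norm v)"
      by (intro image_eqI[of _ _ "cinner v h"]) simp_all
  qed
qed

text \<open>There are uncountably many families \<open>c\<close>, but each value of
  \<open>\<Phi> m\<close> depends on finitely many coordinates, so restricted families suffice. This
  yields the countable dense sets of vectors, of compact operators and of module elements.\<close>

lemma countable_range_finitely_determined:
  fixes \<Phi> :: "nat \<Rightarrow> (int \<Rightarrow> 'a) \<Rightarrow> 'b" and C :: "'a set"
  assumes C: "countable C"
    and \<Phi>: "\<And>m c c'. (\<And>a::int. a \<in> {- int m..int m} \<Longrightarrow> c a = c' a) \<Longrightarrow> \<Phi> m c = \<Phi> m c'"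
  shows "countable {\<Phi> m c | m c. \<forall>a. c a \<in> C}"
proof (rule countable_subset)
  show "{\<Phi> m c | m c. \<forall>a. c a \<in> C} \<subseteq> (\<Union>m. \<Phi> m ` (PiE {- int m..int m} (\<lambda>_. C)))"
  proof clarify
    fix m and c :: "int \<Rightarrow> 'a" assume "\<forall>a. c a \<in> C"
    then have "restrict c {- int m..int m} \<in> PiE {- int m..int m} (\<lambda>_. C)"
      by simp
    moreover have "\<Phi> m c = \<Phi> m (restrict c {- int m..int m})"
      by (rule \<Phi>) simp
    ultimately show "\<Phi> m c \<in> (\<Union>m. \<Phi> m ` (PiE {- int m..int m} (\<lambda>_. C)))"
      by blast
  qed
  show "countable (\<Union>m. \<Phi> m ` (PiE {- int m..int m} (\<lambda>_. C)))"
    by (intro countable_UN countable_image countable_PiE C) auto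
qed

context
  fixes e :: "int \<Rightarrow> 'h::complex_hilbert"
  assumes e: "orthonormal_basis e"
begin

lemma cinner_basis: "cinner (e i) (e j) = (if i = j then 1 else 0)"
  using e by (simp add: orthonormal_basis_def)

lemma norm_basis: "norm (e i) = 1"
  by (simp add: norm_eq_sqrt_cinner cinner_basis)

lemma basis_projection_eq: "basis_projection e m = (\<Sum>a\<in>{- int m..int m}. rank_one (e a) (e a))"
proof -
  define P where "P = (\<Sum>a\<in>{- int m..int m}. rank_one (e a) (e a))"
  define M where "M = complex_vector.span (e ` {- int m..int m})"
  have Pa: "P x = (\<Sum>a\<in>{- int m..int m}. cinner (e a) x *\<^sub>C e a)" for x
    by (simp add: P_def blinfun.sum_left)
  have PM: "P x \<in> M" for x
    unfolding Pa M_def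
    by (intro complex_vector.span_sum complex_vector.span_scale complex_vector.span_base) simp
  have Porth: "cinner y (x - P x) = 0" if "y \<in> M" for x y
    using that unfolding M_def
  proof (induction rule: complex_vector.span_induct_alt)
    case base
    show ?case by simp
  next
    case (step c b y)
    then obtain i where i: "b = e i" "i \<in> {- int m..int m}" by blast
    have "cinner (e i) (P x) = cinner (e i) x"
      using i(2) by (simp add: Pa cinner_sum_right cinner_scaleC_right cinner_basis if_distrib cong: if_cong)
    then show ?case
      using step i by (simp add: cinner_add_left cinner_scaleC_left cinner_diff_right)
  qed
  have "orthogonal_projection M = P"
    unfolding orthogonal_projection_def
  proof (rule the_equality)
    show "\<forall>x. P x \<in> M \<and> (\<forall>y\<in>M. cinner y (x - P x) = 0)"
      using PM Porth by blast
    fix Q :: "'h \<Rightarrow>\<^sub>L 'h" assume Q: "\<forall>x. Q x \<in> M \<and> (\<forall>y\<in>M. cinner y (x - Q x) = 0)"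
    show "Q = P"
    proof (rule blinfun_eqI)
      fix x
      have d: "P x - Q x \<in> M"
        using PM Q unfolding M_def by (blast intro: complex_vector.span_diff)
      \<comment> \<open>\<open>P x - Q x\<close> lies in \<open>M\<close>, hence is orthogonal to
        both residuals and so to their difference, which is \<open>P x - Q x\<close> itself.\<close>
      have "cinner (P x - Q x) (x - Q x) - cinner (P x - Q x) (x - P x) = 0"
        using d Q Porth by simp
      then have "cinner (P x - Q x) (P x - Q x) = 0"
        by (simp add: cinner_diff_right)
      then show "Q x = P x"
        by (simp add: cinner_self)
    qed
  qed
  then show ?thesis
    by (simp add: basis_projection_def M_def P_def)
qed

lemma basis_projection_apply:
  "basis_projection e m x = (\<Sum>a\<in>{- int m..int m}. cinner (e a) x *\<^sub>C e a)"
  by (simp add: basis_projection_eq blinfun.sum_left)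

lemma basis_projection_compact: "basis_projection e m \<in> compact_ops"
  unfolding basis_projection_eq by (intro compact_ops_sum rank_one_compact)

lemma cinner_basis_projection:
  "i \<in> {- int m..int m} \<Longrightarrow> cinner (e i) (basis_projection e m x) = cinner (e i) x"
  by (simp add: basis_projection_apply cinner_sum_right cinner_scaleC_right cinner_basis if_distrib cong: if_cong)

lemma norm_basis_projection_le: "norm (basis_projection e m x) \<le> norm x"
proof -
  let ?P = "basis_projection e m"
  have "cinner (?P x) y = (\<Sum>a\<in>{- int m..int m}. cnj (cinner (e a) x) * cinner (e a) y)" for y
    by (subst cinner_commute)
      (simp add: basis_projection_apply cinner_sum_right cinner_scaleC_right cinner_commute[of y])
  then have "cinner (?P x) (?P x) = cinner (?P x) x"
    using cinner_basis_projection by (auto intro!: sum.cong)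
  then have "(norm (?P x))\<^sup>2 \<le> norm (?P x) * norm x"
    using Re_cinner_le_norm[of "?P x" x] by (simp add: power2_norm_eq_cinner)
  then show ?thesis
    by (cases "?P x = 0") (auto simp: power2_eq_square)
qed

text \<open>On the span of the basis the sequence is eventually constant; since the projections are
  contractions, convergence passes from this dense subspace to all vectors.\<close>

lemma basis_projection_tendsto: "(\<lambda>m. basis_projection e m x) \<longlonglongrightarrow> x"
proof -
  have fin: "\<exists>M. \<forall>m\<ge>M. basis_projection e m y = y" if "y \<in> complex_vector.span (range e)" for y
    using that
  proof (induction rule: complex_vector.span_induct_alt)
    case (step c b y)
    then obtain i M where i: "b = e i" and M: "\<And>m. m \<ge> M \<Longrightarrow> basis_projection e m y = y" by auto
    have "basis_projection e m (c *\<^sub>C b + y) = c *\<^sub>C b + y" if "m \<ge> max M (nat \<bar>i\<bar>)" for m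
    proof -
      have "i \<in> {- int m..int m}" using that by auto
      then have "basis_projection e m (e i) = e i"
        by (simp add: basis_projection_apply cinner_basis if_distrib[of "\<lambda>c. c *\<^sub>C _"] scaleC_one cong: if_cong)
      then show ?thesis
        using M that i by (simp add: blinfun.add_right bounded_opsD compact_ops_bounded basis_projection_compact)
    qed
    then show ?case by blast
  qed auto
  show ?thesis
  proof (rule LIMSEQ_I)
    fix r :: real assume "r > 0"
    have "x \<in> closure (complex_vector.span (range e))"
      using e by (simp add: orthonormal_basis_def)
    then obtain y where y: "y \<in> complex_vector.span (range e)" "dist y x < r / 2"
      using \<open>r > 0\<close> unfolding closure_approachable by (meson half_gt_zero)
    obtain M where M: "\<And>m. m \<ge> M \<Longrightarrow> basis_projection e m y = y"
      using fin[OF y(1)] by blast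
    have "norm (basis_projection e m x - x) < r" if "m \<ge> M" for m
    proof -
      have "basis_projection e m x - x = basis_projection e m (x - y) + (y - x)"
        using M[OF that] by (simp add: blinfun.diff_right)
      then have "norm (basis_projection e m x - x) \<le> norm (x - y) + norm (y - x)"
        using norm_basis_projection_le[of m "x - y"] norm_triangle_ineq[of "basis_projection e m (x - y)" "y - x"]
        by (metis add_right_mono order_trans)
      then show ?thesis
        using y(2) by (simp add: dist_norm norm_minus_commute)
    qed
    then show "\<exists>M. \<forall>m\<ge>M. norm (basis_projection e m x - x) < r" by blast
  qed
qed

text \<open>Pointwise convergence of contractions is uniform on totally bounded sets. The image of
  the unit ball under \<open>T\<close> has a finite net, and at a net point near \<open>T h\<close>
  the error splits into three parts below \<open>r / 4\<close>.\<close>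

lemma basis_projection_compose_tendsto:
  assumes T: "T \<in> compact_ops"
  shows "(\<lambda>m. basis_projection e m o\<^sub>L T) \<longlonglongrightarrow> T"
proof (rule LIMSEQ_I)
  fix r :: real assume "r > 0"
  then have "r / 4 > 0" by simp
  from compact_ops_totally_bounded[OF T this]
  obtain F where F: "finite F" "\<And>h. norm h \<le> 1 \<Longrightarrow> \<exists>x\<in>F. norm (T h - x) < r / 4"
    by blast
  have "\<forall>x\<in>F. eventually (\<lambda>m. norm (basis_projection e m x - x) < r / 4) sequentially"
    using LIMSEQ_D[OF basis_projection_tendsto \<open>r / 4 > 0\<close>]
    unfolding eventually_sequentially by blast
  then have "eventually (\<lambda>m. \<forall>x\<in>F. norm (basis_projection e m x - x) < r / 4) sequentially"
    using F(1) by (simp add: eventually_ball_finite_distrib)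
  then obtain M where M: "\<And>m x. m \<ge> M \<Longrightarrow> x \<in> F \<Longrightarrow> norm (basis_projection e m x - x) < r / 4"
    unfolding eventually_sequentially by blast
  have "norm ((basis_projection e m o\<^sub>L T) - T) < r" if m: "m \<ge> M" for m
  proof -
    let ?P = "basis_projection e m"
    have ball: "norm (((?P o\<^sub>L T) - T) h) \<le> 3 * r / 4" if h: "norm h \<le> 1" for h
    proof -
      obtain x where x: "x \<in> F" "norm (T h - x) < r / 4"
        using F(2)[OF h] by blast
      have "((?P o\<^sub>L T) - T) h = ?P (T h - x) + ((?P x - x) + (x - T h))"
        unfolding blinfun.diff_left blinfun.diff_right blinfun_apply_blinfun_compose by simp
      then have "norm (((?P o\<^sub>L T) - T) h) \<le> norm (T h - x) + (norm (?P x - x) + norm (x - T h))"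
        using norm_basis_projection_le[of m "T h - x"]
          norm_triangle_ineq[of "?P (T h - x)" "(?P x - x) + (x - T h)"]
          norm_triangle_ineq[of "?P x - x" "x - T h"]
        by (simp only:)
      then show ?thesis
        using M[OF m x(1)] x(2) by (simp add: norm_minus_commute)
    qed
    have "norm ((?P o\<^sub>L T) - T) \<le> 3 * r / 4"
    proof (rule norm_blinfun_bound)
      show "norm (((?P o\<^sub>L T) - T) h) \<le> 3 * r / 4 * norm h" for h
      proof (cases "h = 0")
        case False
        have "norm (((?P o\<^sub>L T) - T) (h /\<^sub>R norm h)) \<le> 3 * r / 4"
          using False by (intro ball) simp
        then show ?thesis
          using False by (simp add: blinfun.scaleR_right field_simps)
      qed simp
    qed (use \<open>r > 0\<close> in simp)
    then show ?thesis
      using \<open>r > 0\<close> by linarith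
  qed
  then show "\<exists>M. \<forall>m\<ge>M. norm ((basis_projection e m o\<^sub>L T) - T) < r" by blast
qed

lemma separable_hilbert:
  obtains D where "countable D" "\<And>x \<epsilon>. \<epsilon> > 0 \<Longrightarrow> \<exists>y\<in>D. norm (y - x :: 'h) < \<epsilon>"
proof -
  obtain C :: "complex set" where C: "countable C" "\<And>X. open X \<Longrightarrow> X \<noteq> {} \<Longrightarrow> \<exists>d\<in>C. d \<in> X"
    by (rule countable_dense_setE) blast
  define \<Phi> where "\<Phi> m c = (\<Sum>a\<in>{- int m..int m}. c a *\<^sub>C e a)" for m :: nat and c
  have "\<exists>y\<in>{\<Phi> m c | m c. \<forall>a. c a \<in> C}. norm (y - x) < \<epsilon>" if "\<epsilon> > 0" for x \<epsilon>
  proof -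
    obtain m where m: "norm (basis_projection e m x - x) < \<epsilon> / 2"
      using LIMSEQ_D[OF basis_projection_tendsto, of "\<epsilon> / 2"] \<open>\<epsilon> > 0\<close> by auto
    \<comment> \<open>The \<open>2 * m + 1\<close> coefficients share an error of
      \<open>\<epsilon> / 2\<close>; the other half has gone into the choice of
      \<open>m\<close>.\<close>
    define \<delta> where "\<delta> = \<epsilon> / (2 * (2 * real m + 1))"
    have "\<delta> > 0" using \<open>\<epsilon> > 0\<close> by (simp add: \<delta>_def)
    then have "\<exists>d\<in>C. d \<in> ball (cinner (e a) x) \<delta>" for a
      by (intro C(2)) auto
    then obtain c where c: "\<And>a. c a \<in> C" "\<And>a. cmod (c a - cinner (e a) x) < \<delta>"
      by (metis dist_norm dist_commute mem_ball)
    have "\<Phi> m c - basis_projection e m x = (\<Sum>a\<in>{- int m..int m}. (c a - cinner (e a) x) *\<^sub>C e a)"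
      by (simp add: \<Phi>_def basis_projection_apply sum_subtractf complex_vector.scale_left_diff_distrib)
    also have "norm \<dots> \<le> (\<Sum>a\<in>{- int m..int m}. \<delta>)"
      using c(2) by (intro sum_norm_le) (simp add: norm_scaleC norm_basis less_imp_le)
    also have "\<dots> = \<epsilon> / 2"
      by (simp add: \<delta>_def field_simps)
    finally have "norm (\<Phi> m c - x) < \<epsilon>"
      using m norm_triangle_ineq[of "\<Phi> m c - basis_projection e m x" "basis_projection e m x - x"] by simp
    then show ?thesis
      using c(1) by blast
  qed
  moreover have "countable {\<Phi> m c | m c. \<forall>a. c a \<in> C}"
    by (rule countable_range_finitely_determined[OF C(1)]) (auto simp: \<Phi>_def intro!: sum.cong)
  ultimately show ?thesis
    using that by blast
qed

text \<open>A compact \<open>T\<close> is approximated by \<open>P_m T\<close>, which is the sum of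
  the operators \<open>rank_one (e a) (op_adjoint T (e a))\<close> over \<open>a\<close> in
  \<open>[m]\<close>. Replacing the vectors \<open>op_adjoint T (e a)\<close> by members of a
  countable dense set gives countably many finite-rank operators.\<close>

lemma separable_compact_ops:
  obtains Q :: "('h \<Rightarrow>\<^sub>L 'h) set" where "countable Q" "Q \<subseteq> compact_ops"
    "\<And>T \<epsilon>. T \<in> compact_ops \<Longrightarrow> \<epsilon> > 0 \<Longrightarrow> \<exists>q\<in>Q. norm (q - T) < \<epsilon>"
proof -
  obtain D :: "'h set" where D: "countable D" "\<And>x \<epsilon>. \<epsilon> > 0 \<Longrightarrow> \<exists>y\<in>D. norm (y - x) < \<epsilon>"
    using separable_hilbert by blast
  define \<Phi> where "\<Phi> m v = (\<Sum>a\<in>{- int m..int m}. rank_one (e a) (v a))" for m :: nat and v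
  have "\<exists>q\<in>{\<Phi> m c | m c. \<forall>a. c a \<in> D}. norm (q - T) < \<epsilon>" if T: "T \<in> compact_ops" and "\<epsilon> > 0" for T \<epsilon>
  proof -
    obtain m where m: "norm ((basis_projection e m o\<^sub>L T) - T) < \<epsilon> / 2"
      using LIMSEQ_D[OF basis_projection_compose_tendsto[OF T], of "\<epsilon> / 2"] \<open>\<epsilon> > 0\<close> by auto
    define \<delta> where "\<delta> = \<epsilon> / (2 * (2 * real m + 1))"
    have "\<delta> > 0" using \<open>\<epsilon> > 0\<close> by (simp add: \<delta>_def)
    then have "\<forall>a. \<exists>y. y \<in> D \<and> norm (y - op_adjoint T (e a)) < \<delta>"
      using D(2) by blast
    then obtain v where v: "\<And>a. v a \<in> D" "\<And>a. norm (v a - op_adjoint T (e a)) < \<delta>"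
      by metis
    have "basis_projection e m o\<^sub>L T = (\<Sum>a\<in>{- int m..int m}. rank_one (e a) (op_adjoint T (e a)))"
      by (rule blinfun_eqI)
        (simp add: basis_projection_apply blinfun.sum_left op_adjoint[OF compact_ops_bounded[OF T]])
    then have "\<Phi> m v - (basis_projection e m o\<^sub>L T) = (\<Sum>a\<in>{- int m..int m}. rank_one (e a) (v a - op_adjoint T (e a)))"
      by (simp add: \<Phi>_def sum_subtractf flip: rank_one_diff)
    also have "norm \<dots> \<le> (\<Sum>a\<in>{- int m..int m}. \<delta>)"
    proof (intro sum_norm_le)
      show "norm (rank_one (e a) (v a - op_adjoint T (e a))) \<le> \<delta>" for a
        using norm_rank_one_le[of "e a" "v a - op_adjoint T (e a)"] v(2)[of a] by (simp add: norm_basis)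
    qed
    also have "\<dots> = \<epsilon> / 2"
      by (simp add: \<delta>_def field_simps)
    finally have "norm (\<Phi> m v - T) < \<epsilon>"
      using m norm_triangle_ineq[of "\<Phi> m v - (basis_projection e m o\<^sub>L T)" "(basis_projection e m o\<^sub>L T) - T"] by simp
    then show ?thesis
      using v(1) by blast
  qed
  moreover have "countable {\<Phi> m c | m c. \<forall>a. c a \<in> D}"
    by (rule countable_range_finitely_determined[OF D(1)]) (auto simp: \<Phi>_def intro!: sum.cong)
  moreover have "{\<Phi> m c | m c. \<forall>a. c a \<in> D} \<subseteq> compact_ops"
    by (auto simp: \<Phi>_def intro!: compact_ops_sum rank_one_compact)
  ultimately show ?thesis
    using that by blast
qed

end

subsection \<open>The Hilbert module\<close>

text \<open>Bounds the norm of the operator taking \<open>h\<close> to the family of all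
  \<open>x j h\<close>, \<open>j\<close> in \<open>F\<close>, with the l2 norm on families. For
  infinite \<open>F\<close> the \<open>L2_set\<close> is 0 by convention, so only finite index sets
  carry information.\<close>

definition column_bound :: "int set \<Rightarrow> (int \<Rightarrow> 'h::complex_hilbert \<Rightarrow>\<^sub>L 'h) \<Rightarrow> real \<Rightarrow> bool" where
  "column_bound F x c \<longleftrightarrow> (\<forall>h. L2_set (\<lambda>j. norm (blinfun_apply (x j) h)) F \<le> c * norm h)"

definition gram :: "(int \<Rightarrow> 'h::complex_hilbert \<Rightarrow>\<^sub>L 'h) \<Rightarrow> int \<Rightarrow> 'h \<Rightarrow>\<^sub>L 'h" where
  "gram x j = op_adjoint (x j) o\<^sub>L x j"

lemma L2_set_triangle_norm:
  "L2_set (\<lambda>j. norm (f j + g j)) F \<le> L2_set (\<lambda>j. norm (f j)) F + L2_set (\<lambda>j. norm (g j)) F"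
  by (rule order_trans[OF L2_set_mono L2_set_triangle_ineq]) (auto simp: norm_triangle_ineq)

lemma column_bound_add:
  assumes "column_bound F x a" "column_bound F y b"
  shows "column_bound F (\<lambda>j. x j + y j) (a + b)"
  unfolding column_bound_def
proof
  fix h
  have "L2_set (\<lambda>j. norm ((x j + y j) h)) F \<le> L2_set (\<lambda>j. norm (x j h)) F + L2_set (\<lambda>j. norm (y j h)) F"
    unfolding blinfun.add_left by (rule L2_set_triangle_norm)
  then show "L2_set (\<lambda>j. norm ((x j + y j) h)) F \<le> (a + b) * norm h"
    using assms[unfolded column_bound_def, rule_format, of h] by (simp add: distrib_right)
qed

lemma column_bound_uminus: "column_bound F (\<lambda>j. - x j) a \<longleftrightarrow> column_bound F x a"
  by (simp add: column_bound_def blinfun.minus_left)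

lemma column_bound_diff:
  assumes "column_bound F x a" "column_bound F y b"
  shows "column_bound F (\<lambda>j. x j - y j) (a + b)"
  using column_bound_add[OF assms(1), of "\<lambda>j. - y j" b] assms(2) by (simp add: column_bound_uminus)

lemma column_bound_mono: "column_bound F x a \<Longrightarrow> a \<le> b \<Longrightarrow> column_bound F x b"
  unfolding column_bound_def by (meson mult_right_mono norm_ge_zero order_trans)

lemma column_bound_sum_norm: "column_bound F x (\<Sum>j\<in>F. norm (x j))"
  unfolding column_bound_def
proof
  fix h
  have "L2_set (\<lambda>j. norm (x j h)) F \<le> (\<Sum>j\<in>F. norm (x j h))"
    by (intro L2_set_le_sum) simp
  also have "\<dots> \<le> (\<Sum>j\<in>F. norm (x j) * norm h)"
    by (intro sum_mono norm_blinfun)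
  finally show "L2_set (\<lambda>j. norm (x j h)) F \<le> (\<Sum>j\<in>F. norm (x j)) * norm h"
    by (simp add: sum_distrib_right)
qed

text \<open>One step of a shift combines a left factor, a contraction on the right and an injective
  relabelling of indices; the three are treated at once.\<close>

lemma column_bound_transform:
  assumes "column_bound F x c" and A: "\<And>j. norm (A j) \<le> C" and V: "norm V \<le> 1"
    and "inj_on f G" "f ` G = F" "0 \<le> C" "0 \<le> c"
  shows "column_bound G (\<lambda>j. A j o\<^sub>L x (f j) o\<^sub>L V) (C * c)"
  unfolding column_bound_def
proof
  fix h
  have "L2_set (\<lambda>j. norm ((A j o\<^sub>L x (f j) o\<^sub>L V) h)) G \<le> L2_set (\<lambda>j. C * norm (x (f j) (V h))) G"
  proof (rule L2_set_mono)
    fix j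
    have "norm (A j (x (f j) (V h))) \<le> norm (A j) * norm (x (f j) (V h))"
      by (rule norm_blinfun)
    also have "\<dots> \<le> C * norm (x (f j) (V h))"
      by (intro mult_right_mono A) simp
    finally show "norm ((A j o\<^sub>L x (f j) o\<^sub>L V) h) \<le> C * norm (x (f j) (V h))"
      by simp
  qed simp
  also have "\<dots> = C * L2_set (\<lambda>j. norm (x (f j) (V h))) G"
    using \<open>0 \<le> C\<close> by (simp add: L2_set_right_distrib)
  also have "L2_set (\<lambda>j. norm (x (f j) (V h))) G = L2_set (\<lambda>j. norm (x j (V h))) F"
    using assms(4,5) by (auto simp: L2_set_def sum.reindex)
  also have "C * \<dots> \<le> C * (c * norm (V h))"
    using assms(1,6) by (intro mult_left_mono) (auto simp: column_bound_def)
  also have "\<dots> \<le> C * (c * norm h)"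
    using norm_blinfun[of V h] mult_right_mono[OF V, of "norm h"] assms(6,7)
    by (intro mult_left_mono) auto
  finally show "L2_set (\<lambda>j. norm ((A j o\<^sub>L x (f j) o\<^sub>L V) h)) G \<le> C * c * norm h"
    by (simp add: mult.assoc)
qed

text \<open>With \<open>S\<close> the Gram sum, the square of \<open>norm (S h)\<close> is the sum
  of the inner products of \<open>x j (S h)\<close> with \<open>x j h\<close>. Cauchy-Schwarz in l2
  bounds it by \<open>c * norm (S h)\<close> times \<open>c * norm h\<close>, and one factor
  \<open>norm (S h)\<close> cancels.\<close>

lemma norm_sum_gram_le:
  assumes x: "\<And>j. x j \<in> bounded_ops" and "column_bound F x c" "0 \<le> c"
  shows "norm (\<Sum>j\<in>F. gram x j) \<le> c\<^sup>2"
proof (rule norm_blinfun_bound)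
  fix h
  define S where "S = (\<Sum>j\<in>F. gram x j)"
  have cS: "cinner k (S h) = (\<Sum>j\<in>F. cinner (x j k) (x j h))" for k
    by (simp add: S_def gram_def blinfun.sum_left cinner_sum_right cinner_op_adjoint_right[OF x])
  have "(norm (S h))\<^sup>2 = cmod (cinner (S h) (S h))"
    by (simp add: cinner_self norm_power)
  also have "\<dots> \<le> (\<Sum>j\<in>F. \<bar>norm (x j (S h))\<bar> * \<bar>norm (x j h)\<bar>)"
    unfolding cS by (intro sum_norm_le) (simp add: norm_cinner_le)
  also have "\<dots> \<le> L2_set (\<lambda>j. norm (x j (S h))) F * L2_set (\<lambda>j. norm (x j h)) F"
    by (rule L2_set_mult_ineq)
  also have "\<dots> \<le> (c * norm (S h)) * (c * norm h)"
    using assms(2,3) unfolding column_bound_def by (intro mult_mono) auto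
  finally have "(norm (S h))\<^sup>2 \<le> norm (S h) * (c\<^sup>2 * norm h)"
    by (simp add: power2_eq_square mult_ac)
  then have "norm (S h) \<le> c\<^sup>2 * norm h"
    by (cases "S h = 0") (auto simp: power2_eq_square)
  then show "norm ((\<Sum>j\<in>F. gram x j) h) \<le> c\<^sup>2 * norm h"
    by (simp add: S_def)
qed simp

lemma Re_cinner_gram: "x j \<in> bounded_ops \<Longrightarrow> Re (cinner h (gram x j h)) = (norm (x j h))\<^sup>2"
  by (simp add: gram_def cinner_op_adjoint_right power2_norm_eq_cinner)

text \<open>\<open>S\<close> may be any operator whose quadratic form dominates that of the column,
  so the same estimate serves for the Gram sum over \<open>F\<close> and for the Gram sum over all
  indices.\<close>

lemma column_bound_gram:
  assumes x: "\<And>j. x j \<in> bounded_ops"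
    and S: "\<And>h. (\<Sum>j\<in>F. (norm (blinfun_apply (x j) h))\<^sup>2) \<le> Re (cinner h (blinfun_apply S h))"
    and c: "norm S \<le> c\<^sup>2" "0 \<le> c"
  shows "column_bound F x c"
  unfolding column_bound_def
proof
  fix h
  have "(\<Sum>j\<in>F. (norm (x j h))\<^sup>2) \<le> norm h * norm (S h)"
    using S Re_cinner_le_norm order_trans by blast
  also have "\<dots> \<le> norm h * (norm S * norm h)"
    by (intro mult_left_mono norm_blinfun) simp
  also have "\<dots> \<le> norm h * (c\<^sup>2 * norm h)"
    using c by (intro mult_left_mono mult_right_mono) auto
  also have "\<dots> = (c * norm h)\<^sup>2"
    by (simp add: power2_eq_square mult_ac)
  finally show "L2_set (\<lambda>j. norm (x j h)) F \<le> c * norm h"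
    unfolding L2_set_def using c by (intro real_le_lsqrt) (auto simp: sum_nonneg)
qed

lemma column_bound_norm_sum_gram:
  assumes x: "\<And>j. x j \<in> bounded_ops" and "norm (\<Sum>j\<in>F. gram x j) \<le> c\<^sup>2" "0 \<le> c"
  shows "column_bound F x c"
proof (rule column_bound_gram[OF x _ assms(2,3)])
  show "(\<Sum>j\<in>F. (norm (x j h))\<^sup>2) \<le> Re (cinner h ((\<Sum>j\<in>F. gram x j) h))" for h
    by (simp add: blinfun.sum_left cinner_sum_right Re_cinner_gram[of x, OF x])
qed

section \<open>Membership and norm in \<open>ell2\<close> expressed by column bounds\<close>

lemma ell2_summable: "x \<in> ell2 \<Longrightarrow> gram x summable_on UNIV"
  by (simp add: ell2_def gram_def[abs_def])

lemma ell2_compact: "x \<in> ell2 \<Longrightarrow> x j \<in> compact_ops"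
  by (simp add: ell2_def)

lemma ell2_bounded: "x \<in> ell2 \<Longrightarrow> x j \<in> bounded_ops"
  by (simp add: ell2_compact compact_ops_bounded)

text \<open>The Gram sum over a set \<open>G\<close> disjoint from \<open>F\<close> is a difference
  of two partial sums, each within \<open>\<epsilon>^2 / 2\<close> of the limit.\<close>

lemma ell2_tail:
  assumes x: "x \<in> ell2" and "\<epsilon> > 0"
  obtains F where "finite F" "\<And>G. finite G \<Longrightarrow> G \<inter> F = {} \<Longrightarrow> column_bound G x \<epsilon>"
proof -
  have "(gram x has_sum infsum (gram x) UNIV) UNIV"
    using x by (simp add: ell2_summable)
  then have "eventually (\<lambda>F. dist (sum (gram x) F) (infsum (gram x) UNIV) < \<epsilon>\<^sup>2 / 2) (finite_subsets_at_top UNIV)"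
    using \<open>\<epsilon> > 0\<close> unfolding has_sum_def by (intro tendstoD) simp_all
  then obtain F where F: "finite F"
    "\<And>G. finite G \<Longrightarrow> F \<subseteq> G \<Longrightarrow> dist (sum (gram x) G) (infsum (gram x) UNIV) < \<epsilon>\<^sup>2 / 2"
    unfolding eventually_finite_subsets_at_top by auto
  have "column_bound G x \<epsilon>" if G: "finite G" "G \<inter> F = {}" for G
  proof (rule column_bound_norm_sum_gram)
    have "sum (gram x) G = sum (gram x) (F \<union> G) - sum (gram x) F"
      using F(1) G by (subst sum.union_disjoint) auto
    then have "norm (sum (gram x) G) \<le> dist (sum (gram x) (F \<union> G)) (infsum (gram x) UNIV)
        + dist (sum (gram x) F) (infsum (gram x) UNIV)"
      by (metis dist_norm dist_triangle2)
    then show "norm (sum (gram x) G) \<le> \<epsilon>\<^sup>2"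
      using F(2)[of "F \<union> G"] F(2)[of F] F(1) G(1) by auto
  qed (use \<open>\<epsilon> > 0\<close> ell2_bounded[OF x] in auto)
  then show ?thesis
    using F(1) that by blast
qed

text \<open>Converse of \<open>ell2_tail\<close>: small column tails make the partial Gram sums
  Cauchy, and the space of operators is complete. Closure properties of \<open>ell2\<close> are
  proved with this pair, without manipulating infinite sums of products.\<close>

lemma ell2I:
  assumes x: "\<And>j. x j \<in> compact_ops"
    and tail: "\<And>\<epsilon>. \<epsilon> > 0 \<Longrightarrow> \<exists>F. finite F \<and> (\<forall>G. finite G \<longrightarrow> G \<inter> F = {} \<longrightarrow> column_bound G x \<epsilon>)"
  shows "x \<in> ell2"
proof -
  have "\<exists>P. eventually P (finite_subsets_at_top UNIV) \<and>
          (\<forall>F F'. P F \<and> P F' \<longrightarrow> dist (sum (gram x) F) (sum (gram x) F') < \<epsilon>)" if "\<epsilon> > 0" for \<epsilon>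
  proof -
    obtain F where F: "finite F" "\<And>G. finite G \<Longrightarrow> G \<inter> F = {} \<Longrightarrow> column_bound G x (sqrt (\<epsilon> / 4))"
      using tail[of "sqrt (\<epsilon> / 4)"] \<open>\<epsilon> > 0\<close> by auto
    have close: "dist (sum (gram x) G) (sum (gram x) F) \<le> \<epsilon> / 4" if G: "finite G" "F \<subseteq> G" for G
    proof -
      have "norm (sum (gram x) (G - F)) \<le> (sqrt (\<epsilon> / 4))\<^sup>2"
        using F G \<open>\<epsilon> > 0\<close> x by (intro norm_sum_gram_le) (auto simp: compact_ops_bounded)
      then show ?thesis
        using G F(1) \<open>\<epsilon> > 0\<close> by (simp add: dist_norm sum_diff)
    qed
    have "dist (sum (gram x) G) (sum (gram x) G') < \<epsilon>"
      if "finite G" "F \<subseteq> G" "finite G'" "F \<subseteq> G'" for G G'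
      using close[of G] close[of G'] that \<open>\<epsilon> > 0\<close>
        dist_triangle2[of "sum (gram x) G" "sum (gram x) G'" "sum (gram x) F"] by linarith
    moreover have "eventually (\<lambda>G. finite G \<and> F \<subseteq> G) (finite_subsets_at_top UNIV)"
      using F(1) unfolding eventually_finite_subsets_at_top by auto
    ultimately show ?thesis
      by (intro exI[of _ "\<lambda>G. finite G \<and> F \<subseteq> G"]) auto
  qed
  then have "cauchy_filter (filtermap (sum (gram x)) (finite_subsets_at_top UNIV))"
    by (simp add: cauchy_filter_metric_filtermap)
  moreover have "complete (UNIV :: ('a \<Rightarrow>\<^sub>L 'a) set)"
    by (meson Cauchy_convergent UNIV_I complete_def convergent_def)
  ultimately obtain L where "filtermap (sum (gram x)) (finite_subsets_at_top UNIV) \<le> nhds L"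
    using cauchy_filter_complete_converges[of "filtermap (sum (gram x)) (finite_subsets_at_top UNIV)" UNIV]
    by (auto simp: filtermap_bot_iff)
  then have "(gram x has_sum L) UNIV"
    by (simp add: has_sum_def filterlim_def)
  then show ?thesis
    using x unfolding ell2_def gram_def by (auto simp: summable_on_def)
qed

lemma ell2_norm_eq: "ell2_norm x = sqrt (norm (infsum (gram x) UNIV))"
  by (simp add: ell2_norm_def ell2_inner_def gram_def[abs_def])

lemma ell2_norm_nonneg: "0 \<le> ell2_norm x"
  by (simp add: ell2_norm_eq)

text \<open>For fixed \<open>h\<close> the map \<open>T\<close> to
  \<open>Re (cinner h (T h))\<close> is bounded and linear, so it carries the Gram sum to a sum of
  nonnegative reals, which dominates its finite partial sums. Together with
  \<open>ell2_norm_leI\<close> this makes \<open>ell2_norm x\<close> the least common bound of the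
  finite columns.\<close>

lemma column_bound_ell2_norm:
  assumes x: "x \<in> ell2"
  shows "column_bound F x (ell2_norm x)"
proof (cases "finite F")
  case True
  define S where "S = infsum (gram x) UNIV"
  have S: "(gram x has_sum S) UNIV"
    using x by (simp add: ell2_summable S_def)
  show ?thesis
  proof (rule column_bound_gram)
    fix h
    have "bounded_linear (\<lambda>T :: 'a \<Rightarrow>\<^sub>L 'a. Re (cinner h (T h)))"
      by (intro bounded_linear_compose[OF bounded_linear_Re] bounded_linear_compose[OF bounded_linear_cinner]
          blinfun.bounded_linear_left)
    from has_sum_bounded_linear[OF this S]
    have "((\<lambda>j. (norm (x j h))\<^sup>2) has_sum Re (cinner h (S h))) UNIV"
      by (simp add: o_def Re_cinner_gram ell2_bounded[OF x])
    from finite_sum_le_has_sum[OF this True]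
    show "(\<Sum>j\<in>F. (norm (x j h))\<^sup>2) \<le> Re (cinner h (S h))"
      by simp
  qed (use ell2_bounded[OF x] in \<open>auto simp: ell2_norm_eq S_def\<close>)
qed (auto simp: column_bound_def ell2_norm_nonneg)

lemma ell2_norm_leI:
  assumes x: "x \<in> ell2" and b: "\<And>F. finite F \<Longrightarrow> column_bound F x c" and c: "0 \<le> c"
  shows "ell2_norm x \<le> c"
proof -
  have "(gram x has_sum infsum (gram x) UNIV) UNIV"
    using x by (simp add: ell2_summable)
  then have "norm (infsum (gram x) UNIV) \<le> c\<^sup>2"
    unfolding has_sum_def
  proof (rule Lim_norm_ubound[rotated])
    show "eventually (\<lambda>F. norm (sum (gram x) F) \<le> c\<^sup>2) (finite_subsets_at_top UNIV)"
      by (rule eventually_finite_subsets_at_top_weakI)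
        (auto intro!: norm_sum_gram_le b c ell2_bounded[OF x])
  qed simp
  then show ?thesis
    using c by (simp add: ell2_norm_eq real_le_lsqrt)
qed

lemma norm_le_ell2_norm:
  assumes x: "x \<in> ell2"
  shows "norm (x j) \<le> ell2_norm x"
proof (rule norm_blinfun_bound[OF ell2_norm_nonneg])
  show "norm (x j h) \<le> ell2_norm x * norm h" for h
    using column_bound_ell2_norm[OF x, of "{j}"] by (simp add: column_bound_def)
qed

lemma ell2_norm_eq_0_imp:
  assumes "x \<in> ell2" "ell2_norm x = 0"
  shows "x j = 0"
  using norm_le_ell2_norm[OF assms(1), of j] assms(2) by simp

lemma ell2_add:
  assumes x: "x \<in> ell2" and y: "y \<in> ell2"
  shows "(\<lambda>j. x j + y j) \<in> ell2"
proof (rule ell2I)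
  fix \<epsilon> :: real assume "\<epsilon> > 0"
  then have "\<epsilon> / 2 > 0" by simp
  obtain F where F: "finite F" "\<And>G. finite G \<Longrightarrow> G \<inter> F = {} \<Longrightarrow> column_bound G x (\<epsilon> / 2)"
    using ell2_tail[OF x \<open>\<epsilon> / 2 > 0\<close>] by blast
  obtain F' where F': "finite F'" "\<And>G. finite G \<Longrightarrow> G \<inter> F' = {} \<Longrightarrow> column_bound G y (\<epsilon> / 2)"
    using ell2_tail[OF y \<open>\<epsilon> / 2 > 0\<close>] by blast
  have "column_bound G (\<lambda>j. x j + y j) \<epsilon>" if "finite G" "G \<inter> (F \<union> F') = {}" for G
    using column_bound_add[OF F(2)[of G] F'(2)[of G]] that by (simp add: Int_Un_distrib)
  then show "\<exists>F. finite F \<and> (\<forall>G. finite G \<longrightarrow> G \<inter> F = {} \<longrightarrow> column_bound G (\<lambda>j. x j + y j) \<epsilon>)"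
    using F(1) F'(1) by (intro exI[of _ "F \<union> F'"]) simp
qed (intro compact_ops_add ell2_compact assms)

lemma ell2_uminus:
  assumes x: "x \<in> ell2"
  shows "(\<lambda>j. - x j) \<in> ell2"
proof (rule ell2I)
  fix \<epsilon> :: real assume "\<epsilon> > 0"
  then show "\<exists>F. finite F \<and> (\<forall>G. finite G \<longrightarrow> G \<inter> F = {} \<longrightarrow> column_bound G (\<lambda>j. - x j) \<epsilon>)"
    using ell2_tail[OF x] unfolding column_bound_uminus by metis
next
  show "- x j \<in> compact_ops" for j
    using compact_ops_scaleR[OF ell2_compact[OF x], of "-1" j] by simp
qed

lemma ell2_diff: "x \<in> ell2 \<Longrightarrow> y \<in> ell2 \<Longrightarrow> x - y \<in> ell2"
  using ell2_add[OF _ ell2_uminus, of x y] by (simp add: fun_diff_def)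

lemma ell2_norm_add_le:
  assumes "x \<in> ell2" "y \<in> ell2"
  shows "ell2_norm (\<lambda>j. x j + y j) \<le> ell2_norm x + ell2_norm y"
  by (intro ell2_norm_leI ell2_add assms column_bound_add column_bound_ell2_norm add_nonneg_nonneg ell2_norm_nonneg)

lemma ell2_norm_diff_triangle:
  assumes "x \<in> ell2" "y \<in> ell2" "z \<in> ell2"
  shows "ell2_norm (x - z) \<le> ell2_norm (x - y) + ell2_norm (y - z)"
  using ell2_norm_add_le[OF ell2_diff[OF assms(1,2)] ell2_diff[OF assms(2,3)]] by (simp add: fun_diff_def)

lemma ell2_norm_uminus:
  assumes x: "x \<in> ell2"
  shows "ell2_norm (\<lambda>j. - x j) = ell2_norm x"
proof (rule antisym)
  show "ell2_norm (\<lambda>j. - x j) \<le> ell2_norm x"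
    using x by (intro ell2_norm_leI ell2_uminus) (simp_all add: column_bound_uminus column_bound_ell2_norm ell2_norm_nonneg)
  show "ell2_norm x \<le> ell2_norm (\<lambda>j. - x j)"
    using column_bound_ell2_norm[OF ell2_uminus[OF x]]
    by (intro ell2_norm_leI x) (simp_all add: column_bound_uminus ell2_norm_nonneg)
qed

lemma ell2_norm_minus_commute:
  assumes "x \<in> ell2" "y \<in> ell2"
  shows "ell2_norm (x - y) = ell2_norm (y - x)"
  using ell2_norm_uminus[OF ell2_diff[OF assms]] by (simp add: fun_diff_def)

text \<open>The crude l1 bound is enough for the approximations below, where the finite index window
  is fixed before the entries are made small.\<close>

lemma ell2_finite_support:
  assumes "finite F" and x: "\<And>j. x j \<in> compact_ops" and 0: "\<And>j. j \<notin> F \<Longrightarrow> x j = 0"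
  shows "x \<in> ell2" "ell2_norm x \<le> (\<Sum>j\<in>F. norm (x j))"
proof -
  show "x \<in> ell2"
  proof (rule ell2I[OF x])
    fix \<epsilon> :: real assume "\<epsilon> > 0"
    have "column_bound G x \<epsilon>" if "G \<inter> F = {}" for G
    proof -
      have "x j = 0" if "j \<in> G" for j
        using 0 \<open>G \<inter> F = {}\<close> that by blast
      then show ?thesis
        using \<open>\<epsilon> > 0\<close> by (simp add: column_bound_def L2_set_0')
    qed
    then show "\<exists>F. finite F \<and> (\<forall>G. finite G \<longrightarrow> G \<inter> F = {} \<longrightarrow> column_bound G x \<epsilon>)"
      using \<open>finite F\<close> by blast
  qed
  then show "ell2_norm x \<le> (\<Sum>j\<in>F. norm (x j))"
  proof (rule ell2_norm_leI)
    fix G :: "int set" assume "finite G"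
    have "(\<Sum>j\<in>G. norm (x j)) = (\<Sum>j\<in>G \<inter> F. norm (x j))"
      using 0 \<open>finite G\<close> by (intro sum.mono_neutral_right) auto
    also have "\<dots> \<le> (\<Sum>j\<in>F. norm (x j))"
      using \<open>finite F\<close> by (intro sum_mono2) auto
    finally show "column_bound G x (\<Sum>j\<in>F. norm (x j))"
      using column_bound_mono[OF column_bound_sum_norm] by blast
  qed (simp add: sum_nonneg)
qed

lemma ell2_transform:
  assumes x: "x \<in> ell2" and A: "\<And>j. A j \<in> bounded_ops" "\<And>j. norm (A j) \<le> C"
    and V: "V \<in> bounded_ops" "norm V \<le> 1"
  shows "(\<lambda>j. A j o\<^sub>L x (j + k) o\<^sub>L V) \<in> ell2"
    and "ell2_norm (\<lambda>j. A j o\<^sub>L x (j + k) o\<^sub>L V) \<le> C * ell2_norm x"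
proof -
  have C: "0 \<le> C"
    using A(2)[of 0] norm_ge_zero order_trans by blast
  have inj: "inj_on (\<lambda>j. j + k) G" for G
    by (simp add: inj_on_def)
  show *: "(\<lambda>j. A j o\<^sub>L x (j + k) o\<^sub>L V) \<in> ell2"
  proof (rule ell2I)
    fix \<epsilon> :: real assume "\<epsilon> > 0"
    \<comment> \<open>The summand 1 makes the denominator positive, as only \<open>0 \<le> C\<close>
      is at hand.\<close>
    then have "\<epsilon> / (C + 1) > 0" using C by simp
    obtain F where F: "finite F" "\<And>G. finite G \<Longrightarrow> G \<inter> F = {} \<Longrightarrow> column_bound G x (\<epsilon> / (C + 1))"
      using ell2_tail[OF x \<open>\<epsilon> / (C + 1) > 0\<close>] by blast
    have "column_bound G (\<lambda>j. A j o\<^sub>L x (j + k) o\<^sub>L V) \<epsilon>" if G: "finite G" "G \<inter> (\<lambda>j. j - k) ` F = {}" for G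
    proof -
      have "(\<lambda>j. j + k) ` G \<inter> F = {}"
        using G(2) by force
      then have "column_bound G (\<lambda>j. A j o\<^sub>L x (j + k) o\<^sub>L V) (C * (\<epsilon> / (C + 1)))"
        using F(2)[of "(\<lambda>j. j + k) ` G"] G(1) \<open>\<epsilon> / (C + 1) > 0\<close>
        by (intro column_bound_transform[OF _ A(2) V(2) inj refl C]) auto
      moreover have "C * (\<epsilon> / (C + 1)) \<le> \<epsilon>"
        using C \<open>\<epsilon> > 0\<close> by (simp add: field_simps)
      ultimately show ?thesis
        by (rule column_bound_mono)
    qed
    then show "\<exists>F. finite F \<and> (\<forall>G. finite G \<longrightarrow> G \<inter> F = {} \<longrightarrow> column_bound G (\<lambda>j. A j o\<^sub>L x (j + k) o\<^sub>L V) \<epsilon>)"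
      using F(1) by (intro exI[of _ "(\<lambda>j. j - k) ` F"]) auto
  qed (intro compact_ops_compose_left compact_ops_compose_right A V ell2_compact x)
  then show "ell2_norm (\<lambda>j. A j o\<^sub>L x (j + k) o\<^sub>L V) \<le> C * ell2_norm x"
    by (rule ell2_norm_leI)
      (auto intro!: column_bound_transform[OF _ A(2) V(2) inj refl C] column_bound_ell2_norm x
        ell2_norm_nonneg C mult_nonneg_nonneg)
qed

section \<open>Completeness and approximation by finitely supported sequences\<close>

lemma ell2_norm_diff_eq_0:
  assumes "x \<in> ell2" "y \<in> ell2"
  shows "ell2_norm (x - y) = 0 \<longleftrightarrow> x = y"
proof
  assume "ell2_norm (x - y) = 0"
  then have "(x - y) j = 0" for j
    by (intro ell2_norm_eq_0_imp ell2_diff assms)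
  then show "x = y" by (auto simp: fun_eq_iff)
next
  assume "x = y"
  then show "ell2_norm (x - y) = 0"
    using ell2_finite_support(2)[of "{}" "x - y"] ell2_norm_nonneg[of "x - y"] by (simp add: compact_ops_zero)
qed

text \<open>The limit is taken entrywise. Letting \<open>m\<close> tend to infinity in the column
  bounds of \<open>X n - X m\<close>, for fixed \<open>F\<close> and \<open>h\<close>, gives
  \<open>near\<close> uniformly in \<open>F\<close> before \<open>x\<close> is known to lie in
  \<open>ell2\<close>; it then yields both membership and convergence.\<close>

lemma ell2_complete:
  assumes X: "\<And>n. X n \<in> ell2"
    and Cauchy: "\<And>\<epsilon>. \<epsilon> > 0 \<Longrightarrow> \<exists>M. \<forall>m\<ge>M. \<forall>n\<ge>M. ell2_norm (X m - X n) < \<epsilon>"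
  shows "\<exists>x\<in>ell2. (\<lambda>n. ell2_norm (X n - x)) \<longlonglongrightarrow> 0"
proof -
  have "Cauchy (\<lambda>n. X n j)" for j
  proof (rule metric_CauchyI)
    fix \<epsilon> :: real assume "\<epsilon> > 0"
    then obtain M where M: "\<And>m n. m \<ge> M \<Longrightarrow> n \<ge> M \<Longrightarrow> ell2_norm (X m - X n) < \<epsilon>"
      using Cauchy by blast
    have "dist (X m j) (X n j) < \<epsilon>" if "m \<ge> M" "n \<ge> M" for m n
      using norm_le_ell2_norm[OF ell2_diff[OF X[of m] X[of n]], of j] M[OF that] by (simp add: dist_norm)
    then show "\<exists>M. \<forall>m\<ge>M. \<forall>n\<ge>M. dist (X m j) (X n j) < \<epsilon>" by blast
  qed
  then have "\<exists>l. (\<lambda>n. X n j) \<longlonglongrightarrow> l" for j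
    by (simp add: Cauchy_convergent_iff convergent_def)
  then obtain x where x: "\<And>j. (\<lambda>n. X n j) \<longlonglongrightarrow> x j"
    by metis
  have near: "\<exists>M. \<forall>n\<ge>M. \<forall>F. column_bound F (\<lambda>j. X n j - x j) \<epsilon>" if "\<epsilon> > 0" for \<epsilon>
  proof -
    obtain M where M: "\<And>m n. m \<ge> M \<Longrightarrow> n \<ge> M \<Longrightarrow> ell2_norm (X m - X n) < \<epsilon>"
      using Cauchy \<open>\<epsilon> > 0\<close> by blast
    have "column_bound F (\<lambda>j. X n j - x j) \<epsilon>" if n: "n \<ge> M" for n F
      unfolding column_bound_def
    proof
      fix h
      have "(\<lambda>m. L2_set (\<lambda>j. norm ((X n j - X m j) h)) F) \<longlonglongrightarrow> L2_set (\<lambda>j. norm ((X n j - x j) h)) F"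
        unfolding L2_set_def
        by (intro tendsto_intros blinfun.tendsto x)
      moreover have "eventually (\<lambda>m. L2_set (\<lambda>j. norm ((X n j - X m j) h)) F \<le> \<epsilon> * norm h) sequentially"
        using eventually_ge_at_top[of M]
      proof eventually_elim
        case (elim m)
        have "column_bound F (X n - X m) \<epsilon>"
          using M[OF n elim] by (intro column_bound_mono[OF column_bound_ell2_norm[OF ell2_diff[OF X X]]]) simp
        then show ?case by (simp add: column_bound_def)
      qed
      ultimately show "L2_set (\<lambda>j. norm ((X n j - x j) h)) F \<le> \<epsilon> * norm h"
        by (intro tendsto_upperbound[of _ _ sequentially]) auto
    qed
    then show ?thesis by blast
  qed
  have "x \<in> ell2"
  proof (rule ell2I)
    show "x j \<in> compact_ops" for j
      using compact_ops_lim[OF x] ell2_compact[OF X] by blast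
    fix \<epsilon> :: real assume "\<epsilon> > 0"
    then have "\<epsilon> / 2 > 0" by simp
    obtain n where n: "\<And>F. column_bound F (\<lambda>j. X n j - x j) (\<epsilon> / 2)"
      using near[OF \<open>\<epsilon> / 2 > 0\<close>] by blast
    obtain F where F: "finite F" "\<And>G. finite G \<Longrightarrow> G \<inter> F = {} \<Longrightarrow> column_bound G (X n) (\<epsilon> / 2)"
      using ell2_tail[OF X \<open>\<epsilon> / 2 > 0\<close>] by blast
    have "column_bound G x \<epsilon>" if "finite G" "G \<inter> F = {}" for G
      using column_bound_diff[OF F(2)[OF that] n] by simp
    then show "\<exists>F. finite F \<and> (\<forall>G. finite G \<longrightarrow> G \<inter> F = {} \<longrightarrow> column_bound G x \<epsilon>)"
      using F(1) by blast
  qed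
  moreover have "(\<lambda>n. ell2_norm (X n - x)) \<longlonglongrightarrow> 0"
  proof (rule LIMSEQ_I)
    fix \<epsilon> :: real assume "\<epsilon> > 0"
    then have "\<epsilon> / 2 > 0" by simp
    obtain M where M: "\<And>n F. n \<ge> M \<Longrightarrow> column_bound F (\<lambda>j. X n j - x j) (\<epsilon> / 2)"
      using near[OF \<open>\<epsilon> / 2 > 0\<close>] by blast
    have "norm (ell2_norm (X n - x) - 0) < \<epsilon>" if "n \<ge> M" for n
    proof -
      have "ell2_norm (X n - x) \<le> \<epsilon> / 2"
        using M[OF that] \<open>\<epsilon> > 0\<close> by (intro ell2_norm_leI ell2_diff X \<open>x \<in> ell2\<close>) (auto simp: fun_diff_def)
      then show ?thesis
        using ell2_norm_nonneg[of "X n - x"] \<open>\<epsilon> > 0\<close> by simp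
    qed
    then show "\<exists>M. \<forall>n\<ge>M. norm (ell2_norm (X n - x) - 0) < \<epsilon>" by blast
  qed
  ultimately show ?thesis by blast
qed

lemma ell2_truncate:
  assumes x: "x \<in> ell2" and "\<epsilon> > 0"
  obtains J :: nat where "J \<ge> 1" "ell2_norm ((\<lambda>j. if j \<in> {- int J..int J} then x j else 0) - x) < \<epsilon>"
proof -
  have "\<epsilon> / 2 > 0" using \<open>\<epsilon> > 0\<close> by simp
  obtain F where F: "finite F" "\<And>G. finite G \<Longrightarrow> G \<inter> F = {} \<Longrightarrow> column_bound G x (\<epsilon> / 2)"
    using ell2_tail[OF x \<open>\<epsilon> / 2 > 0\<close>] by blast
  \<comment> \<open>The sum exceeds every single absolute value, so the window contains
    \<open>F\<close>; \<open>Suc\<close> ensures \<open>J \<ge> 1\<close>.\<close>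
  define J where "J = Suc (\<Sum>j\<in>F. nat \<bar>j\<bar>)"
  define y where "y = (\<lambda>j. if j \<in> {- int J..int J} then x j else 0)"
  have FJ: "j \<in> {- int J..int J}" if "j \<in> F" for j
  proof -
    have "nat \<bar>j\<bar> \<le> (\<Sum>j\<in>F. nat \<bar>j\<bar>)"
      using that F(1) by (intro member_le_sum) auto
    then have "nat \<bar>j\<bar> \<le> J"
      unfolding J_def by (rule le_SucI)
    then show ?thesis by auto
  qed
  have y: "y \<in> ell2"
    by (rule ell2_finite_support(1)[of "{- int J..int J}"]) (auto simp: y_def compact_ops_zero ell2_compact[OF x])
  have "ell2_norm (y - x) \<le> \<epsilon> / 2"
  proof (rule ell2_norm_leI[OF ell2_diff[OF y x]])
    fix G :: "int set" assume "finite G"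
    show "column_bound G (y - x) (\<epsilon> / 2)"
      unfolding column_bound_def
    proof
      fix h
      have "(\<Sum>j\<in>G. (norm ((y - x) j h))\<^sup>2) = (\<Sum>j\<in>G - {- int J..int J}. (norm ((y - x) j h))\<^sup>2)"
        using \<open>finite G\<close> by (intro sum.mono_neutral_right) (auto simp: y_def)
      also have "\<dots> = (\<Sum>j\<in>G - {- int J..int J}. (norm (x j h))\<^sup>2)"
        by (intro sum.cong) (auto simp: y_def blinfun.minus_left)
      finally have "L2_set (\<lambda>j. norm ((y - x) j h)) G = L2_set (\<lambda>j. norm (x j h)) (G - {- int J..int J})"
        by (simp add: L2_set_def)
      also have "\<dots> \<le> \<epsilon> / 2 * norm h"
        using F(2)[of "G - {- int J..int J}"] \<open>finite G\<close> FJ unfolding column_bound_def by blast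
      finally show "L2_set (\<lambda>j. norm ((y - x) j h)) G \<le> \<epsilon> / 2 * norm h" .
    qed
  qed (use \<open>\<epsilon> > 0\<close> in simp)
  then show ?thesis
    using that[of J] \<open>\<epsilon> > 0\<close> by (simp add: J_def y_def)
qed

text \<open>\<open>Q\<close> is a parameter because two dense sets of entries are used: a countable
  one for separability, and the operators of the form \<open>P_m T\<close> for the
  criterion.\<close>

lemma ell2_approx_finite_support:
  assumes x: "x \<in> ell2" and "\<epsilon> > 0"
    and Q: "\<And>T \<epsilon>. T \<in> compact_ops \<Longrightarrow> \<epsilon> > 0 \<Longrightarrow> \<exists>q\<in>Q. norm (q - T) < \<epsilon>" "Q \<subseteq> compact_ops"
  shows "\<exists>J\<ge>1. \<exists>q. (\<forall>j. q j \<in> Q) \<and> ell2_norm ((\<lambda>j. if j \<in> {- int J..int J} then q j else 0) - x) < \<epsilon>"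
proof -
  have "\<epsilon> / 2 > 0" using \<open>\<epsilon> > 0\<close> by simp
  from ell2_truncate[OF x this] obtain J :: nat where J: "J \<ge> 1"
    "ell2_norm ((\<lambda>j. if j \<in> {- int J..int J} then x j else 0) - x) < \<epsilon> / 2"
    by blast
  define y where "y = (\<lambda>j. if j \<in> {- int J..int J} then x j else 0)"
  define \<delta> where "\<delta> = \<epsilon> / (2 * (2 * real J + 1))"
  have "\<delta> > 0" using \<open>\<epsilon> > 0\<close> by (simp add: \<delta>_def)
  then have "\<forall>j. \<exists>q. q \<in> Q \<and> norm (q - x j) < \<delta>"
    using Q(1) ell2_compact[OF x] by blast
  then obtain q where q: "\<And>j. q j \<in> Q" "\<And>j. norm (q j - x j) < \<delta>"
    by metis
  define z where "z = (\<lambda>j. if j \<in> {- int J..int J} then q j else 0)"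
  have y: "y \<in> ell2"
    by (rule ell2_finite_support(1)[of "{- int J..int J}"]) (auto simp: y_def compact_ops_zero ell2_compact[OF x])
  have z: "z \<in> ell2"
    by (rule ell2_finite_support(1)[of "{- int J..int J}"]) (use Q(2) q(1) in \<open>auto simp: z_def compact_ops_zero\<close>)
  have "ell2_norm (z - y) \<le> (\<Sum>j\<in>{- int J..int J}. norm ((z - y) j))"
    using ell2_compact[OF ell2_diff[OF z y]]
    by (intro ell2_finite_support(2)) (auto simp: z_def y_def)
  also have "\<dots> \<le> (\<Sum>j\<in>{- int J..int J}. \<delta>)"
    using q(2) by (intro sum_mono) (auto simp: z_def y_def less_imp_le)
  also have "\<dots> = \<epsilon> / 2"
    by (simp add: \<delta>_def field_simps)
  finally have "ell2_norm (z - x) < \<epsilon>"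
    using J(2) ell2_norm_diff_triangle[OF z y x] by (simp add: y_def)
  then show ?thesis
    using J(1) q(1) unfolding z_def by blast
qed

subsection \<open>Transitive sequences of maps\<close>

text \<open>Formulated for a carrier set and a function \<open>N\<close>, since \<open>ell2\<close>
  is a set of functions and not a type with its own norm. The vectors with dense orbit contain a
  countable intersection of open dense sets.\<close>

lemma transitive_imp_densely_hypercyclic:
  fixes X :: "'x::minus set" and N :: "'x \<Rightarrow> real" and T :: "nat \<Rightarrow> 'x \<Rightarrow> 'x"
  assumes N_nonneg: "\<And>x y. x \<in> X \<Longrightarrow> y \<in> X \<Longrightarrow> 0 \<le> N (x - y)"
    and N_commute: "\<And>x y. x \<in> X \<Longrightarrow> y \<in> X \<Longrightarrow> N (x - y) = N (y - x)"
    and N_zero: "\<And>x y. x \<in> X \<Longrightarrow> y \<in> X \<Longrightarrow> N (x - y) = 0 \<longleftrightarrow> x = y"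
    and N_triangle: "\<And>x y z. x \<in> X \<Longrightarrow> y \<in> X \<Longrightarrow> z \<in> X \<Longrightarrow> N (x - z) \<le> N (x - y) + N (y - z)"
    and complete: "\<And>s. (\<And>n. s n \<in> X) \<Longrightarrow> (\<And>\<epsilon>. \<epsilon> > 0 \<Longrightarrow> \<exists>M::nat. \<forall>m\<ge>M. \<forall>n\<ge>M. N (s m - s n) < \<epsilon>)
        \<Longrightarrow> \<exists>x\<in>X. (\<lambda>n. N (s n - x)) \<longlonglongrightarrow> 0"
    and S: "countable S" "norm_dense X N S"
    and T: "\<And>n x. x \<in> X \<Longrightarrow> T n x \<in> X"
    and cont: "\<And>n x \<epsilon>. x \<in> X \<Longrightarrow> \<epsilon> > 0 \<Longrightarrow> \<exists>\<delta>>0. \<forall>y\<in>X. N (y - x) < \<delta> \<longrightarrow> N (T n y - T n x) < \<epsilon>"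
    and transitive: "\<And>x y \<epsilon>. x \<in> X \<Longrightarrow> y \<in> X \<Longrightarrow> \<epsilon> > 0 \<Longrightarrow>
        \<exists>n. \<exists>u\<in>X. N (u - x) < \<epsilon> \<and> N (T n u - y) < \<epsilon>"
  shows "densely_hypercyclic X N T"
proof -
  \<comment> \<open>The value 0 outside \<open>X\<close> is chosen because
    \<open>Metric_space\<close> demands nonnegativity and symmetry for all arguments.\<close>
  define d where "d x y = (if x \<in> X \<and> y \<in> X then N (x - y) else 0)" for x y
  interpret Metric_space X d
    by unfold_locales (auto simp: d_def N_nonneg N_commute N_zero N_triangle)
  have ball: "y \<in> mball x r \<longleftrightarrow> x \<in> X \<and> y \<in> X \<and> N (y - x) < r" for x y r
    by (auto simp: d_def N_commute[of x y])
  have "mcomplete"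
    unfolding mcomplete_def
  proof (intro allI impI)
    fix s :: "nat \<Rightarrow> 'x" assume s: "MCauchy s"
    have sX: "s n \<in> X" for n
      using s by (auto simp: MCauchy_def)
    have "\<exists>M. \<forall>m\<ge>M. \<forall>n\<ge>M. N (s m - s n) < \<epsilon>" if "\<epsilon> > 0" for \<epsilon>
      using s that unfolding MCauchy_def by (simp add: d_def sX)
    from complete[of s, OF sX this] obtain x where x: "x \<in> X" "(\<lambda>n. N (s n - x)) \<longlonglongrightarrow> 0"
      by blast
    then have "limitin mtopology s x sequentially"
      unfolding limitin_metric_dist_null by (simp add: d_def sX)
    then show "\<exists>x. limitin mtopology s x sequentially" ..
  qed
  have SX: "S \<subseteq> X"
    using S(2) by (simp add: norm_dense_def)
  \<comment> \<open>Vectors whose orbit comes within \<open>1 / (k + 1)\<close> of \<open>s\<close>.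
    A vector in all of these sets has an orbit approximating every point of \<open>S\<close>, hence
    every point of \<open>X\<close>.\<close>
  define O' where "O' s k = {x \<in> X. \<exists>n. N (T n x - s) < inverse (real (Suc k))}" for s k
  define \<G> where "\<G> = (\<lambda>(s, k). O' s k) ` (S \<times> UNIV)"
  have "openin mtopology (O' s k)" if s: "s \<in> S" for s k
    unfolding openin_mtopology
  proof (intro conjI allI impI)
    fix x assume "x \<in> O' s k"
    then obtain n where x: "x \<in> X" "N (T n x - s) < inverse (real (Suc k))"
      by (auto simp: O'_def)
    \<comment> \<open>Continuity is applied with the slack that the strict inequality at
      \<open>x\<close> leaves.\<close>
    obtain \<delta> where \<delta>: "\<delta> > 0" "\<And>y. y \<in> X \<Longrightarrow> N (y - x) < \<delta> \<Longrightarrow> N (T n y - T n x) < inverse (real (Suc k)) - N (T n x - s)"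
      using cont[OF x(1), of "inverse (real (Suc k)) - N (T n x - s)" n] x(2) by auto
    have "mball x \<delta> \<subseteq> O' s k"
    proof
      fix y assume "y \<in> mball x \<delta>"
      then have y: "y \<in> X" "N (y - x) < \<delta>"
        unfolding ball by blast+
      have "N (T n y - s) \<le> N (T n y - T n x) + N (T n x - s)"
        using s SX by (intro N_triangle T x y) auto
      also have "\<dots> < inverse (real (Suc k))"
        using \<delta>(2)[OF y] by linarith
      finally show "y \<in> O' s k"
        using y by (auto simp: O'_def)
    qed
    with \<delta>(1) show "\<exists>r>0. mball x r \<subseteq> O' s k" by blast
  qed (auto simp: O'_def)
  moreover have "mtopology closure_of (O' s k) = X" if s: "s \<in> S" for s k
  proof -
    have "\<exists>y\<in>O' s k. y \<in> mball x r" if x: "x \<in> X" and "r > 0" for x r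
    proof -
      obtain n u where u: "u \<in> X" "N (u - x) < min r (inverse (real (Suc k)))"
          "N (T n u - s) < min r (inverse (real (Suc k)))"
        using transitive[OF x, of s "min r (inverse (real (Suc k)))"] \<open>r > 0\<close> s SX by auto
      then have "u \<in> O' s k" by (auto simp: O'_def)
      moreover have "u \<in> mball x r"
        using u x unfolding ball by simp
      ultimately show ?thesis by blast
    qed
    then show ?thesis
      unfolding metric_closure_of by blast
  qed
  ultimately have dense: "mtopology closure_of \<Inter>\<G> = X"
    using S(1) by (intro metric_Baire_category \<open>mcomplete\<close>) (auto simp: \<G>_def)
  have hyp: "norm_dense X N (range (\<lambda>n. T n x))" if x: "x \<in> X" "x \<in> \<Inter>\<G>" for x
    unfolding norm_dense_def
  proof (intro conjI ballI allI impI)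
    fix y \<epsilon> assume y: "y \<in> X" and "(\<epsilon>::real) > 0"
    obtain s where s: "s \<in> S" "N (s - y) < \<epsilon> / 2"
      using S(2) y \<open>\<epsilon> > 0\<close> unfolding norm_dense_def by (meson half_gt_zero)
    obtain k where k: "inverse (real (Suc k)) < \<epsilon> / 2"
      using reals_Archimedean[of "\<epsilon> / 2"] \<open>\<epsilon> > 0\<close> by auto
    have "x \<in> O' s k"
      using x(2) s(1) by (auto simp: \<G>_def)
    then obtain n where n: "N (T n x - s) < inverse (real (Suc k))"
      by (auto simp: O'_def)
    have "N (T n x - y) \<le> N (T n x - s) + N (s - y)"
      using s SX by (intro N_triangle T x y) auto
    then have "N (T n x - y) < \<epsilon>"
      using n k s(2) by linarith
    then show "\<exists>z\<in>range (\<lambda>n. T n x). N (z - y) < \<epsilon>"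
      by blast
  qed (use T x in auto)
  show ?thesis
    unfolding densely_hypercyclic_def norm_dense_def[of X N "{x \<in> X. _ x}"]
  proof (intro conjI ballI allI impI)
    fix x \<epsilon> assume x: "x \<in> X" and "(\<epsilon>::real) > 0"
    then obtain y where y: "y \<in> \<Inter>\<G>" "y \<in> mball x \<epsilon>"
      using dense unfolding metric_closure_of by blast
    then show "\<exists>y\<in>{x \<in> X. norm_dense X N (range (\<lambda>n. T n x))}. N (y - x) < \<epsilon>"
      using hyp[of y] unfolding ball by (intro bexI[of _ y]) auto
  qed auto
qed

subsection \<open>Weighted shifts\<close>

lemma blinfun_compose_assoc: "(a o\<^sub>L b) o\<^sub>L c = a o\<^sub>L (b o\<^sub>L c)"
  by (rule blinfun_eqI) simp

lemma blinfun_compose_id: "id_blinfun o\<^sub>L a = a" "a o\<^sub>L id_blinfun = a"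
  by (rule blinfun_eqI, simp)+

text \<open>Right multiplication by \<open>V\<close> does not increase the norm and is undone by
  right multiplication by the contraction \<open>V'\<close>. This removes the unitary from the norm
  estimates.\<close>

lemma norm_compose_isometry_right:
  fixes A :: "'h::complex_hilbert \<Rightarrow>\<^sub>L 'h"
  assumes "norm V \<le> 1" "norm V' \<le> 1" "V o\<^sub>L V' = id_blinfun"
  shows "norm (A o\<^sub>L V) = norm A"
proof (rule antisym)
  show "norm (A o\<^sub>L V) \<le> norm A"
    using norm_blinfun_compose[of A V] mult_left_mono[OF assms(1), of "norm A"] by simp
  have "A = (A o\<^sub>L V) o\<^sub>L V'"
    using assms(3) by (metis blinfun_compose_assoc blinfun_compose_id(2))
  then have "norm A \<le> norm (A o\<^sub>L V) * norm V'"
    using norm_blinfun_compose[of "A o\<^sub>L V" V'] by metis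
  then show "norm A \<le> norm (A o\<^sub>L V)"
    using mult_left_mono[OF assms(2), of "norm (A o\<^sub>L V)"] by simp
qed

text \<open>The weighted shift is the case \<open>k = -1\<close>, its inverse is the case \<open>k = 1\<close>.\<close>

definition gen_shift ::
    "(int \<Rightarrow> 'h::complex_hilbert \<Rightarrow>\<^sub>L 'h) \<Rightarrow> ('h \<Rightarrow>\<^sub>L 'h) \<Rightarrow> int \<Rightarrow>
     (int \<Rightarrow> 'h \<Rightarrow>\<^sub>L 'h) \<Rightarrow> (int \<Rightarrow> 'h \<Rightarrow>\<^sub>L 'h)" where
  "gen_shift A V k x = (\<lambda>\<xi>. A \<xi> o\<^sub>L x (\<xi> + k) o\<^sub>L V)"

lemma weighted_shift_eq_gen_shift: "weighted_shift U W = gen_shift W U (-1)"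
  by (simp add: weighted_shift_def gen_shift_def fun_eq_iff)

lemma op_prod_const_commute: "V o\<^sub>L op_prod (\<lambda>_. V) n = op_prod (\<lambda>_. V) n o\<^sub>L V"
proof (induction n)
  case (Suc n)
  have "V o\<^sub>L op_prod (\<lambda>_. V) (Suc n) = V o\<^sub>L (op_prod (\<lambda>_. V) n o\<^sub>L V)"
    by (simp only: op_prod.simps Suc)
  then show ?case
    by (simp add: blinfun_compose_assoc)
qed (simp add: blinfun_compose_id)

text \<open>Factor 0 of \<open>op_prod\<close> acts first, so the weights are counted from the
  source \<open>j = \<xi> + k * n\<close>, and the last one is \<open>A \<xi>\<close>. With
  \<open>k = -1\<close> and \<open>A = W\<close> the factors are \<open>W (j + 1)\<close>, ...,
  \<open>W (j + n)\<close>, as in the criterion.\<close>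

lemma gen_shift_funpow:
  "(gen_shift A V k ^^ n) x \<xi> =
     op_prod (\<lambda>i. A (\<xi> + k * int n - k * (1 + int i))) n o\<^sub>L x (\<xi> + k * int n) o\<^sub>L op_prod (\<lambda>_. V) n"
proof (induction n arbitrary: \<xi>)
  case 0
  show ?case by (simp add: blinfun_compose_id)
next
  case (Suc n)
  have "(gen_shift A V k ^^ Suc n) x \<xi> = A \<xi> o\<^sub>L (gen_shift A V k ^^ n) x (\<xi> + k) o\<^sub>L V"
    by (simp add: gen_shift_def)
  then show ?case
    unfolding Suc by (simp add: algebra_simps blinfun_compose_assoc op_prod_const_commute)
qed

lemma gen_shift_funpow_add:
  "(gen_shift A V k ^^ n) (\<lambda>j. x j + y j) = (\<lambda>j. (gen_shift A V k ^^ n) x j + (gen_shift A V k ^^ n) y j)"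
  by (rule ext, rule blinfun_eqI) (simp add: gen_shift_funpow blinfun.add_left blinfun.add_right)

lemma gen_shift_funpow_diff:
  "(gen_shift A V k ^^ n) (x - y) = (gen_shift A V k ^^ n) x - (gen_shift A V k ^^ n) y"
  by (rule ext, rule blinfun_eqI) (simp add: gen_shift_funpow blinfun.diff_left blinfun.diff_right)

context
  fixes A :: "int \<Rightarrow> 'h::complex_hilbert \<Rightarrow>\<^sub>L 'h" and V V' :: "'h \<Rightarrow>\<^sub>L 'h" and C :: real
  assumes A: "\<And>j. A j \<in> bounded_ops" "\<And>j. norm (A j) \<le> C"
    and V: "V \<in> bounded_ops" "norm V \<le> 1" "norm V' \<le> 1" "V o\<^sub>L V' = id_blinfun"
begin

lemma gen_shift_funpow_ell2:
  assumes x: "x \<in> ell2"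
  shows "(gen_shift A V k ^^ n) x \<in> ell2"
    and "ell2_norm ((gen_shift A V k ^^ n) x) \<le> C ^ n * ell2_norm x"
proof (induction n)
  case 0
  case 1 show ?case using x by simp
  case 2 show ?case by simp
next
  case (Suc n)
  have C: "0 \<le> C"
    using A(2)[of 0] norm_ge_zero order_trans by blast
  case 1 show ?case
    using ell2_transform(1)[OF Suc.IH(1) A V(1,2)] by (simp only: funpow.simps o_apply gen_shift_def[of A V k "(gen_shift A V k ^^ n) x"])
  case 2
  have "ell2_norm ((gen_shift A V k ^^ Suc n) x) \<le> C * ell2_norm ((gen_shift A V k ^^ n) x)"
    using ell2_transform(2)[OF Suc.IH(1) A V(1,2)] by (simp only: funpow.simps o_apply gen_shift_def[of A V k "(gen_shift A V k ^^ n) x"])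
  also have "\<dots> \<le> C * (C ^ n * ell2_norm x)"
    using C by (intro mult_left_mono Suc.IH(2))
  finally show ?case by (simp add: mult.assoc)
qed

text \<open>Reads the iterate at the place to which the entry with index \<open>j\<close> has been
  moved; the powers of \<open>V\<close> on the right are peeled off one at a time without changing
  the norm.\<close>

lemma norm_gen_shift_funpow:
  "norm ((gen_shift A V k ^^ n) x (j - k * int n)) = norm (op_prod (\<lambda>i. A (j - k * (1 + int i))) n o\<^sub>L x j)"
proof -
  have "norm (B o\<^sub>L op_prod (\<lambda>_. V) n) = norm B" for B :: "'h \<Rightarrow>\<^sub>L 'h"
  proof (induction n arbitrary: B)
    case (Suc n)
    have "norm (B o\<^sub>L op_prod (\<lambda>_. V) (Suc n)) = norm ((B o\<^sub>L V) o\<^sub>L op_prod (\<lambda>_. V) n)"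
      by (simp add: blinfun_compose_assoc)
    also have "\<dots> = norm (B o\<^sub>L V)"
      by (rule Suc)
    also have "\<dots> = norm B"
      by (rule norm_compose_isometry_right[OF V(2-4)])
    finally show ?case .
  qed (simp add: blinfun_compose_id)
  then show ?thesis
    by (simp add: gen_shift_funpow)
qed

lemma ell2_norm_gen_shift_funpow_le:
  assumes F: "finite F" and z: "\<And>j. z j \<in> compact_ops" "\<And>j. j \<notin> F \<Longrightarrow> z j = 0"
  shows "ell2_norm ((gen_shift A V k ^^ n) z) \<le>
    (\<Sum>j\<in>F. norm (op_prod (\<lambda>i. A (j - k * (1 + int i))) n o\<^sub>L z j))"
proof -
  have "z \<in> ell2"
    by (rule ell2_finite_support(1)[OF F z])
  then have "ell2_norm ((gen_shift A V k ^^ n) z) \<le>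
      (\<Sum>\<xi>\<in>(\<lambda>j. j - k * int n) ` F. norm ((gen_shift A V k ^^ n) z \<xi>))"
  proof (intro ell2_finite_support(2) ell2_compact gen_shift_funpow_ell2)
    fix \<xi> assume "\<xi> \<notin> (\<lambda>j. j - k * int n) ` F"
    then have "\<xi> + k * int n \<notin> F"
      by (metis add_diff_cancel_right' imageI)
    then show "(gen_shift A V k ^^ n) z \<xi> = 0"
      using z(2) by (intro blinfun_eqI) (simp add: gen_shift_funpow)
  qed (use F in simp)
  also have "\<dots> = (\<Sum>j\<in>F. norm ((gen_shift A V k ^^ n) z (j - k * int n)))"
    by (subst sum.reindex) (auto simp: inj_on_def)
  finally show ?thesis
    by (simp add: norm_gen_shift_funpow)
qed

end

text \<open>The direction \<open>k\<close> is kept general so that \<open>k = 1\<close> and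
  \<open>k = -1\<close> give the two inverse laws for the weighted shift.\<close>

lemma gen_shift_inverse:
  assumes "\<And>j. B j o\<^sub>L A (j + k) = id_blinfun" "V o\<^sub>L V' = id_blinfun"
  shows "gen_shift B V' k (gen_shift A V (- k) x) = x"
proof
  fix \<xi>
  have "gen_shift B V' k (gen_shift A V (- k) x) \<xi> = (B \<xi> o\<^sub>L A (\<xi> + k)) o\<^sub>L x \<xi> o\<^sub>L (V o\<^sub>L V')"
    by (simp add: gen_shift_def blinfun_compose_assoc)
  then show "gen_shift B V' k (gen_shift A V (- k) x) \<xi> = x \<xi>"
    by (simp add: assms blinfun_compose_id)
qed

lemma funpow_left_inverse:
  fixes S T :: "'a \<Rightarrow> 'a"
  assumes "\<And>x. S (T x) = x"
  shows "(S ^^ n) ((T ^^ n) x) = x"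
proof (induction n)
  case (Suc n)
  have "(S ^^ Suc n) ((T ^^ Suc n) x) = (S ^^ n) (S (T ((T ^^ n) x)))"
    by (subst funpow_Suc_right) simp
  then show ?case
    by (simp add: assms Suc)
qed simp

lemma op_inverse:
  assumes "invertible_op T"
  shows "op_inverse T \<in> bounded_ops" "op_inverse T o\<^sub>L T = id_blinfun" "T o\<^sub>L op_inverse T = id_blinfun"
proof -
  have "\<exists>!S. S \<in> bounded_ops \<and> S o\<^sub>L T = id_blinfun \<and> T o\<^sub>L S = id_blinfun"
  proof (rule ex_ex1I)
    show "\<exists>S. S \<in> bounded_ops \<and> S o\<^sub>L T = id_blinfun \<and> T o\<^sub>L S = id_blinfun"
      using assms by (auto simp: invertible_op_def)
    fix S S' assume S: "S \<in> bounded_ops \<and> S o\<^sub>L T = id_blinfun \<and> T o\<^sub>L S = id_blinfun"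
      and S': "S' \<in> bounded_ops \<and> S' o\<^sub>L T = id_blinfun \<and> T o\<^sub>L S' = id_blinfun"
    have "S = S o\<^sub>L (T o\<^sub>L S')"
      using S' by (simp add: blinfun_compose_id)
    also have "\<dots> = S'"
      using S by (simp add: blinfun_compose_id flip: blinfun_compose_assoc)
    finally show "S = S'" .
  qed
  from theI'[OF this]
  show "op_inverse T \<in> bounded_ops" "op_inverse T o\<^sub>L T = id_blinfun" "T o\<^sub>L op_inverse T = id_blinfun"
    unfolding op_inverse_def by blast+
qed

section \<open>Approximation by entries fixed by a basis projection, and separability of
  \<open>ell2\<close>\<close>

lemma basis_projection_absorb:
  assumes e: "orthonormal_basis e" and "m' \<le> m"
  shows "basis_projection e m o\<^sub>L basis_projection e m' = basis_projection e m'"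
proof (rule blinfun_eqI)
  fix x
  have sub: "{- int m'..int m'} \<subseteq> {- int m..int m}" using \<open>m' \<le> m\<close> by auto
  have b: "basis_projection e m (e i) = e i" if "i \<in> {- int m..int m}" for i
    using that
    by (simp add: basis_projection_apply[OF e] cinner_basis[OF e] if_distrib[of "\<lambda>c. c *\<^sub>C _"] scaleC_one cong: if_cong)
  have "basis_projection e m (basis_projection e m' x)
      = (\<Sum>a\<in>{- int m'..int m'}. cinner (e a) x *\<^sub>C basis_projection e m (e a))"
    by (simp add: basis_projection_apply[OF e, of m'] blinfun.sum_right
        bounded_opsD compact_ops_bounded basis_projection_compact[OF e])
  also have "\<dots> = basis_projection e m' x"
    unfolding basis_projection_apply[OF e, of m'] using sub b by (intro sum.cong) auto
  finally show "(basis_projection e m o\<^sub>L basis_projection e m') x = basis_projection e m' x"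
    by simp
qed

text \<open>The invariance holds for all \<open>m' \<ge> m\<close>, so that two approximated vectors
  can later share one projection.\<close>

lemma ell2_approx_basis_projection:
  assumes e: "orthonormal_basis e" and x: "x \<in> ell2" and "\<epsilon> > 0"
  obtains J m :: nat and x' where "x' \<in> ell2" "\<And>j. j \<notin> {- int J..int J} \<Longrightarrow> x' j = 0"
    "\<And>j m'. m \<le> m' \<Longrightarrow> basis_projection e m' o\<^sub>L x' j = x' j" "ell2_norm (x' - x) < \<epsilon>"
proof -
  define Q where "Q = {basis_projection e m o\<^sub>L T | m T. T \<in> compact_ops}"
  have Q: "Q \<subseteq> compact_ops"
    by (auto simp: Q_def intro!: compact_ops_compose_left compact_ops_bounded basis_projection_compact e)
  have "\<exists>q\<in>Q. norm (q - T) < \<delta>" if T: "T \<in> compact_ops" and "\<delta> > 0" for T \<delta>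
    using LIMSEQ_D[OF basis_projection_compose_tendsto[OF e T] \<open>\<delta> > 0\<close>] T unfolding Q_def by blast
  from ell2_approx_finite_support[OF x \<open>\<epsilon> > 0\<close> this Q] obtain J q
    where q: "\<And>j. q j \<in> Q" "ell2_norm ((\<lambda>j. if j \<in> {- int J..int J} then q j else 0) - x) < \<epsilon>"
    by blast
  define x' where "x' = (\<lambda>j. if j \<in> {- int J..int J} then q j else 0)"
  have "\<exists>m T. q j = basis_projection e m o\<^sub>L T" for j
    using q(1)[of j] by (auto simp: Q_def)
  then obtain m T where mT: "\<And>j. q j = basis_projection e (m j) o\<^sub>L T j"
    by metis
  \<comment> \<open>An upper bound for the finitely many \<open>m j\<close>; by absorption the
    projections beyond it fix every entry.\<close>
  define M where "M = (\<Sum>j\<in>{- int J..int J}. m j)"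
  have "basis_projection e m' o\<^sub>L x' j = x' j" if "M \<le> m'" for j m'
  proof (cases "j \<in> {- int J..int J}")
    case True
    then have "m j \<le> M"
      unfolding M_def by (intro member_le_sum) auto
    then have "basis_projection e m' o\<^sub>L (basis_projection e (m j) o\<^sub>L T j) = basis_projection e (m j) o\<^sub>L T j"
      using that basis_projection_absorb[OF e, of "m j" m'] by (simp flip: blinfun_compose_assoc)
    then show ?thesis
      using True by (simp add: x'_def mT)
  qed (auto simp: x'_def)
  moreover have "x' \<in> ell2"
    using q(1) Q by (intro ell2_finite_support(1)[of "{- int J..int J}"]) (auto simp: x'_def compact_ops_zero)
  ultimately show ?thesis
    using q(2) by (intro that[of x' J M]) (auto simp: x'_def)
qed

lemma ell2_separable:
  fixes e :: "int \<Rightarrow> 'h::complex_hilbert"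
  assumes e: "orthonormal_basis e"
  obtains S :: "(int \<Rightarrow> 'h \<Rightarrow>\<^sub>L 'h) set" where "countable S" "norm_dense ell2 ell2_norm S"
proof -
  obtain Q :: "('h \<Rightarrow>\<^sub>L 'h) set" where Q: "countable Q" "Q \<subseteq> compact_ops"
    "\<And>T \<epsilon>. T \<in> compact_ops \<Longrightarrow> \<epsilon> > 0 \<Longrightarrow> \<exists>q\<in>Q. norm (q - T) < \<epsilon>"
    using separable_compact_ops[OF e] by blast
  define \<Phi> where "\<Phi> J q = (\<lambda>j. if j \<in> {- int J..int J} then q j else 0)" for J :: nat and q :: "int \<Rightarrow> 'h \<Rightarrow>\<^sub>L 'h"
  define S where "S = {\<Phi> J q | J q. \<forall>j. q j \<in> Q}"
  have "countable S"
    unfolding S_def by (rule countable_range_finitely_determined[OF Q(1)]) (auto simp: \<Phi>_def fun_eq_iff)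
  moreover have "norm_dense ell2 ell2_norm S"
    unfolding norm_dense_def
  proof (intro conjI ballI allI impI)
    have "\<Phi> J q \<in> ell2" if "\<forall>j. q j \<in> Q" for J q
      using that Q(2) by (intro ell2_finite_support(1)[of "{- int J..int J}"]) (auto simp: \<Phi>_def compact_ops_zero)
    then show "S \<subseteq> ell2"
      by (auto simp: S_def)
    fix x :: "int \<Rightarrow> 'h \<Rightarrow>\<^sub>L 'h" and \<epsilon> :: real assume "x \<in> ell2" "\<epsilon> > 0"
    from ell2_approx_finite_support[OF this Q(3,2)] show "\<exists>y\<in>S. ell2_norm (y - x) < \<epsilon>"
      unfolding S_def \<Phi>_def by blast
  qed
  ultimately show ?thesis
    using that by blast
qed

text \<open>Solving \<open>y_\<xi> = W_\<xi> x_{\<xi> - 1} U\<close> for \<open>x\<close> involves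
  the weight and the entry at \<open>\<xi> + 1\<close>, hence the displaced index.\<close>

definition weighted_shift_inverse ::
    "('h::complex_hilbert \<Rightarrow>\<^sub>L 'h) \<Rightarrow> (int \<Rightarrow> 'h \<Rightarrow>\<^sub>L 'h) \<Rightarrow>
     (int \<Rightarrow> 'h \<Rightarrow>\<^sub>L 'h) \<Rightarrow> (int \<Rightarrow> 'h \<Rightarrow>\<^sub>L 'h)" where
  "weighted_shift_inverse U W = gen_shift (\<lambda>\<xi>. op_inverse (W (\<xi> + 1))) (op_adjoint U) 1"

section \<open>Iterates of the weighted shift and the two implications\<close>

context
  fixes W :: "int \<Rightarrow> 'h::complex_hilbert \<Rightarrow>\<^sub>L 'h"
    and U :: "'h \<Rightarrow>\<^sub>L 'h"
    and C :: real
  assumes W: "\<And>j. invertible_op (W j)" "\<And>j. norm (W j) \<le> C" "\<And>j. norm (op_inverse (W j)) \<le> C"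
    and U: "unitary_op U"
begin

lemma W_bounded: "W j \<in> bounded_ops"
  using W(1)[of j] by (simp add: invertible_op_def)

lemma U_facts:
  "U \<in> bounded_ops" "norm U \<le> 1" "norm (op_adjoint U) \<le> 1" "U o\<^sub>L op_adjoint U = id_blinfun"
  "op_adjoint U o\<^sub>L U = id_blinfun" "op_adjoint U \<in> bounded_ops"
proof -
  show "norm U \<le> 1" "norm (op_adjoint U) \<le> 1"
    using unitary_op_norm[OF U] unitary_op_adjoint_norm[OF U] by (auto intro!: norm_blinfun_bound)
  show "U \<in> bounded_ops" "op_adjoint U \<in> bounded_ops"
    using U op_adjoint_bounded_ops by (auto simp: unitary_op_def)
qed (use U in \<open>auto simp: unitary_op_def\<close>)

lemma shift_ell2:
  assumes "x \<in> ell2"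
  shows "(weighted_shift U W ^^ n) x \<in> ell2" "ell2_norm ((weighted_shift U W ^^ n) x) \<le> C ^ n * ell2_norm x"
  unfolding weighted_shift_eq_gen_shift
  using gen_shift_funpow_ell2[OF W_bounded W(2) U_facts(1,2,3,4) assms] by auto

lemma shift_inverse_ell2:
  assumes "x \<in> ell2"
  shows "(weighted_shift_inverse U W ^^ n) x \<in> ell2"
  unfolding weighted_shift_inverse_def
  by (rule gen_shift_funpow_ell2(1)[OF op_inverse(1)[OF W(1)] W(3) U_facts(6,3,2,5) assms])

lemma norm_shift:
  "norm ((weighted_shift U W ^^ n) x (j + int n)) = norm (op_prod (\<lambda>i. W (j + 1 + int i)) n o\<^sub>L x j)"
  using norm_gen_shift_funpow[where A = W and k = "-1" and n = n and x = x and j = j,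
      OF W_bounded W(2) U_facts(1,2,3,4)]
  by (simp add: weighted_shift_eq_gen_shift algebra_simps)

lemma norm_shift_inverse:
  "norm ((weighted_shift_inverse U W ^^ n) x (j - int n)) = norm (op_prod (\<lambda>i. op_inverse (W (j - int i))) n o\<^sub>L x j)"
  using norm_gen_shift_funpow[where A = "\<lambda>\<xi>. op_inverse (W (\<xi> + 1))" and k = 1 and n = n and x = x and j = j,
      OF op_inverse(1)[OF W(1)] W(3) U_facts(6,3,2,5)]
  by (simp add: weighted_shift_inverse_def)

lemma ell2_norm_shift_le:
  assumes "finite F" "\<And>j. z j \<in> compact_ops" "\<And>j. j \<notin> F \<Longrightarrow> z j = 0"
  shows "ell2_norm ((weighted_shift U W ^^ n) z) \<le> (\<Sum>j\<in>F. norm (op_prod (\<lambda>i. W (j + 1 + int i)) n o\<^sub>L z j))"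
  using ell2_norm_gen_shift_funpow_le[where A = W and z = z and k = "-1" and n = n,
      OF W_bounded W(2) U_facts(1,2,3,4) assms]
  by (simp add: weighted_shift_eq_gen_shift algebra_simps)

lemma ell2_norm_shift_inverse_le:
  assumes "finite F" "\<And>j. z j \<in> compact_ops" "\<And>j. j \<notin> F \<Longrightarrow> z j = 0"
  shows "ell2_norm ((weighted_shift_inverse U W ^^ n) z) \<le> (\<Sum>j\<in>F. norm (op_prod (\<lambda>i. op_inverse (W (j - int i))) n o\<^sub>L z j))"
  using ell2_norm_gen_shift_funpow_le[where A = "\<lambda>\<xi>. op_inverse (W (\<xi> + 1))" and z = z and k = 1 and n = n,
      OF op_inverse(1)[OF W(1)] W(3) U_facts(6,3,2,5) assms]
  by (simp add: weighted_shift_inverse_def)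

lemma shift_inverse_shift: "(weighted_shift_inverse U W ^^ n) ((weighted_shift U W ^^ n) x) = x"
  unfolding weighted_shift_inverse_def weighted_shift_eq_gen_shift
  by (rule funpow_left_inverse, rule gen_shift_inverse) (simp_all add: op_inverse[OF W(1)] U_facts)

lemma shift_shift_inverse: "(weighted_shift U W ^^ n) ((weighted_shift_inverse U W ^^ n) x) = x"
proof (rule funpow_left_inverse)
  fix x
  show "weighted_shift U W (weighted_shift_inverse U W x) = x"
    unfolding weighted_shift_inverse_def weighted_shift_eq_gen_shift
    using gen_shift_inverse[of W "\<lambda>\<xi>. op_inverse (W (\<xi> + 1))" "-1" "op_adjoint U" U x]
    by (simp add: op_inverse[OF W(1)] U_facts)
qed

lemma shift_continuous:
  assumes x: "x \<in> ell2" and "\<epsilon> > 0"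
  shows "\<exists>\<delta>>0. \<forall>y\<in>ell2. ell2_norm (y - x) < \<delta> \<longrightarrow> ell2_norm ((weighted_shift U W ^^ n) y - (weighted_shift U W ^^ n) x) < \<epsilon>"
proof (intro exI conjI ballI impI)
  have C: "0 \<le> C"
    using W(2)[of 0] norm_ge_zero order_trans by blast
  \<comment> \<open>The witness for \<open>\<delta>\<close>, from the operator bound
    \<open>C ^ n\<close>; the summand 1 keeps the denominator positive.\<close>
  then show "\<epsilon> / (C ^ n + 1) > 0"
    using \<open>\<epsilon> > 0\<close> by (simp add: add_nonneg_pos)
  fix y assume y: "y \<in> ell2" "ell2_norm (y - x) < \<epsilon> / (C ^ n + 1)"
  have "ell2_norm ((weighted_shift U W ^^ n) y - (weighted_shift U W ^^ n) x) = ell2_norm ((weighted_shift U W ^^ n) (y - x))"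
    by (simp add: weighted_shift_eq_gen_shift gen_shift_funpow_diff)
  also have "\<dots> \<le> C ^ n * ell2_norm (y - x)"
    by (intro shift_ell2 ell2_diff x y)
  also have "\<dots> \<le> (C ^ n + 1) * ell2_norm (y - x)"
    by (intro mult_right_mono ell2_norm_nonneg) simp
  also have "\<dots> < \<epsilon>"
    using y(2) C by (simp add: pos_less_divide_eq add_nonneg_pos mult.commute)
  finally show "ell2_norm ((weighted_shift U W ^^ n) y - (weighted_shift U W ^^ n) x) < \<epsilon>" .
qed

text \<open>The errors \<open>D x - x = (D - P) x\<close> and \<open>G y - y = (G - P) y\<close>
  vanish because \<open>P\<close> fixes the entries of \<open>x\<close> and \<open>y\<close>. The
  iterate of \<open>D x\<close> and the inverse iterate of \<open>G y\<close> vanish by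
  \<open>WD\<close> and \<open>WG\<close>. All four limits concern finitely many entries, so a
  single \<open>k\<close> serves.\<close>

lemma criterion_imp_transitive:
  fixes D G :: "int \<Rightarrow> nat \<Rightarrow> 'h \<Rightarrow>\<^sub>L 'h" and s :: "nat \<Rightarrow> nat"
  assumes compact: "\<And>j k. j \<in> {- int J..int J} \<Longrightarrow> D j k \<in> compact_ops \<and> G j k \<in> compact_ops"
    and D: "\<And>j. j \<in> {- int J..int J} \<Longrightarrow> (\<lambda>k. norm (D j k - P)) \<longlonglongrightarrow> 0"
    and G: "\<And>j. j \<in> {- int J..int J} \<Longrightarrow> (\<lambda>k. norm (G j k - P)) \<longlonglongrightarrow> 0"
    and WD: "\<And>j. j \<in> {- int J..int J} \<Longrightarrow>
      (\<lambda>k. norm (op_prod (\<lambda>i. W (j + 1 + int i)) (s k) o\<^sub>L D j k)) \<longlonglongrightarrow> 0"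
    and WG: "\<And>j. j \<in> {- int J..int J} \<Longrightarrow>
      (\<lambda>k. norm (op_prod (\<lambda>i. op_inverse (W (j - int i))) (s k) o\<^sub>L G j k)) \<longlonglongrightarrow> 0"
    and x: "x \<in> ell2" "\<And>j. j \<notin> {- int J..int J} \<Longrightarrow> x j = 0" "\<And>j. P o\<^sub>L x j = x j"
    and y: "y \<in> ell2" "\<And>j. j \<notin> {- int J..int J} \<Longrightarrow> y j = 0" "\<And>j. P o\<^sub>L y j = y j"
    and "\<epsilon> > 0"
  shows "\<exists>k. \<exists>u\<in>ell2. ell2_norm (u - x) < \<epsilon> \<and> ell2_norm ((weighted_shift U W ^^ s k) u - y) < \<epsilon>"
proof -
  define I where "I = {- int J..int J}"
  define a where "a k = (\<lambda>j. if j \<in> I then D j k o\<^sub>L x j else 0)" for k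
  define b where "b k = (\<lambda>j. if j \<in> I then G j k o\<^sub>L y j else 0)" for k
  have fin: "finite I" by (simp add: I_def)
  have ac: "a k j \<in> compact_ops" and bc: "b k j \<in> compact_ops" for k j
    using compact compact_ops_compose_left[OF compact_ops_bounded ell2_compact[OF x(1)]]
      compact_ops_compose_left[OF compact_ops_bounded ell2_compact[OF y(1)]]
    by (auto simp: a_def b_def I_def compact_ops_zero)
  have a0: "a k j = 0" and b0: "b k j = 0" if "j \<notin> I" for k j
    using that by (simp_all add: a_def b_def)
  have a_ell2: "a k \<in> ell2" and b_ell2: "b k \<in> ell2" for k
    using ell2_finite_support(1)[OF fin ac a0] ell2_finite_support(1)[OF fin bc b0] by auto
  have prod: "norm (A o\<^sub>L (B o\<^sub>L z)) \<le> norm (A o\<^sub>L B) * norm z" for A B z :: "'h \<Rightarrow>\<^sub>L 'h"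
    by (metis blinfun_compose_assoc norm_blinfun_compose)
  have diff: "norm ((B o\<^sub>L z) - z) \<le> norm (B - P) * norm z" if "P o\<^sub>L z = z" for B z :: "'h \<Rightarrow>\<^sub>L 'h"
  proof -
    have "(B o\<^sub>L z) - z = (B - P) o\<^sub>L z"
      by (subst (2) that[symmetric], rule blinfun_eqI) (simp add: blinfun.diff_left)
    then show ?thesis
      by (metis norm_blinfun_compose)
  qed
  \<comment> \<open>\<open>\<alpha>\<close> bounds the distance from \<open>u\<close> to
    \<open>x\<close>, and \<open>\<beta>\<close> that from the iterate of \<open>u\<close> to
    \<open>y\<close>; each pairs an approximation error with a decaying weight product.\<close>
  define \<alpha> where "\<alpha> k = (\<Sum>j\<in>I. norm (D j k - P) * norm (x j)) +
      (\<Sum>j\<in>I. norm (op_prod (\<lambda>i. op_inverse (W (j - int i))) (s k) o\<^sub>L G j k) * norm (y j))" for k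
  define \<beta> where "\<beta> k = (\<Sum>j\<in>I. norm (op_prod (\<lambda>i. W (j + 1 + int i)) (s k) o\<^sub>L D j k) * norm (x j)) +
      (\<Sum>j\<in>I. norm (G j k - P) * norm (y j))" for k
  have "\<alpha> \<longlonglongrightarrow> (\<Sum>j\<in>I. 0 * norm (x j)) + (\<Sum>j\<in>I. 0 * norm (y j))"
    unfolding \<alpha>_def by (intro tendsto_intros D WG) (simp_all add: I_def)
  moreover have "\<beta> \<longlonglongrightarrow> (\<Sum>j\<in>I. 0 * norm (x j)) + (\<Sum>j\<in>I. 0 * norm (y j))"
    unfolding \<beta>_def by (intro tendsto_intros G WD) (simp_all add: I_def)
  ultimately have "eventually (\<lambda>k. \<alpha> k < \<epsilon> \<and> \<beta> k < \<epsilon>) sequentially"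
    using \<open>\<epsilon> > 0\<close> by (intro eventually_conj order_tendstoD(2)) auto
  then obtain k where k: "\<alpha> k < \<epsilon>" "\<beta> k < \<epsilon>"
    by (auto simp: eventually_sequentially)
  define u where "u = (\<lambda>j. a k j + (weighted_shift_inverse U W ^^ s k) (b k) j)"
  have u: "u \<in> ell2"
    unfolding u_def by (intro ell2_add a_ell2 shift_inverse_ell2 b_ell2)
  have "ell2_norm (u - x) \<le> ell2_norm (a k - x) + ell2_norm ((weighted_shift_inverse U W ^^ s k) (b k))"
  proof -
    have "u - x = (\<lambda>j. (a k - x) j + (weighted_shift_inverse U W ^^ s k) (b k) j)"
      by (simp add: u_def fun_eq_iff)
    then show ?thesis
      using ell2_norm_add_le[OF ell2_diff[OF a_ell2 x(1)] shift_inverse_ell2[OF b_ell2]] by simp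
  qed
  also have "ell2_norm (a k - x) \<le> (\<Sum>j\<in>I. norm ((a k - x) j))"
    using ell2_compact[OF ell2_diff[OF a_ell2 x(1)]] x(2) a0
    by (intro ell2_finite_support(2) fin) (auto simp: I_def)
  also have "\<dots> \<le> (\<Sum>j\<in>I. norm (D j k - P) * norm (x j))"
    using diff x(3) by (intro sum_mono) (simp add: a_def)
  also have "ell2_norm ((weighted_shift_inverse U W ^^ s k) (b k)) \<le>
      (\<Sum>j\<in>I. norm (op_prod (\<lambda>i. op_inverse (W (j - int i))) (s k) o\<^sub>L b k j))"
    by (rule ell2_norm_shift_inverse_le[OF fin bc b0])
  also have "\<dots> \<le> (\<Sum>j\<in>I. norm (op_prod (\<lambda>i. op_inverse (W (j - int i))) (s k) o\<^sub>L G j k) * norm (y j))"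
    using prod by (intro sum_mono) (simp add: b_def)
  finally have ux: "ell2_norm (u - x) \<le> \<alpha> k"
    by (simp add: \<alpha>_def)
  have Tu: "(weighted_shift U W ^^ s k) u = (\<lambda>j. (weighted_shift U W ^^ s k) (a k) j + b k j)"
    unfolding u_def weighted_shift_eq_gen_shift gen_shift_funpow_add
    by (simp add: shift_shift_inverse flip: weighted_shift_eq_gen_shift)
  have "ell2_norm ((weighted_shift U W ^^ s k) u - y) \<le> ell2_norm ((weighted_shift U W ^^ s k) (a k)) + ell2_norm (b k - y)"
  proof -
    have "(weighted_shift U W ^^ s k) u - y = (\<lambda>j. (weighted_shift U W ^^ s k) (a k) j + (b k - y) j)"
      by (simp add: Tu fun_eq_iff)
    then show ?thesis
      using ell2_norm_add_le[OF shift_ell2(1)[OF a_ell2] ell2_diff[OF b_ell2 y(1)]] by simp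
  qed
  also have "ell2_norm (b k - y) \<le> (\<Sum>j\<in>I. norm ((b k - y) j))"
    using ell2_compact[OF ell2_diff[OF b_ell2 y(1)]] y(2) b0
    by (intro ell2_finite_support(2) fin) (auto simp: I_def)
  also have "\<dots> \<le> (\<Sum>j\<in>I. norm (G j k - P) * norm (y j))"
    using diff y(3) by (intro sum_mono) (simp add: b_def)
  also have "ell2_norm ((weighted_shift U W ^^ s k) (a k)) \<le> (\<Sum>j\<in>I. norm (op_prod (\<lambda>i. W (j + 1 + int i)) (s k) o\<^sub>L a k j))"
    by (rule ell2_norm_shift_le[OF fin ac a0])
  also have "\<dots> \<le> (\<Sum>j\<in>I. norm (op_prod (\<lambda>i. W (j + 1 + int i)) (s k) o\<^sub>L D j k) * norm (x j))"
    using prod by (intro sum_mono) (simp add: a_def)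
  finally have "ell2_norm ((weighted_shift U W ^^ s k) u - y) \<le> \<beta> k"
    by (simp add: \<beta>_def)
  then show ?thesis
    using ux u k by (intro exI[of _ k] bexI[of _ u]) auto
qed

text \<open>Since the orbit is dense and \<open>ell2\<close> has no isolated points, the orbit still meets every ball after
  removal of finitely many of its points; hence both the index and the exponent can be taken large.\<close>

lemma hypercyclic_imp_approximants:
  fixes e :: "int \<Rightarrow> 'h" and t :: "nat \<Rightarrow> nat"
  assumes e: "orthonormal_basis e"
    and hyp: "densely_hypercyclic ell2 ell2_norm (\<lambda>n. weighted_shift U W ^^ t n)" and "\<epsilon> > 0"
  shows "\<exists>n>N. \<exists>D G. (\<forall>j. D j \<in> compact_ops \<and> G j \<in> compact_ops) \<and>
    (\<forall>j\<in>{- int J..int J}. norm (D j - basis_projection e m) < \<epsilon> \<and> norm (G j - basis_projection e m) < \<epsilon> \<and>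
      norm (op_prod (\<lambda>i. W (j + 1 + int i)) (t n) o\<^sub>L D j) < \<epsilon> \<and>
      norm (op_prod (\<lambda>i. op_inverse (W (j - int i))) (t n) o\<^sub>L G j) < \<epsilon>)"
proof -
  define P where "P = basis_projection e m"
  have P: "P \<in> compact_ops"
    by (simp add: P_def basis_projection_compact[OF e])
  \<comment> \<open>A one-parameter family of targets: \<open>X 0\<close> has entries
    \<open>P\<close> on the window, and its rescalings supply infinitely many targets arbitrarily
    close to it.\<close>
  define X where "X c = (\<lambda>j. if j \<in> {- int J..int J} then (1 + c) *\<^sub>R P else 0)" for c :: real
  have X: "X c \<in> ell2" for c
    by (rule ell2_finite_support(1)[of "{- int J..int J}"]) (auto simp: X_def compact_ops_zero compact_ops_scaleR P)
  have "P (e 0) = e 0"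
    \<comment> \<open>The index 0 belongs to every window, so \<open>e 0\<close> witnesses
      \<open>P \<noteq> 0\<close>, on which the injectivity of \<open>X\<close> rests.\<close>
    by (simp add: P_def basis_projection_apply[OF e] cinner_basis[OF e] if_distrib[of "\<lambda>c. c *\<^sub>C _"] scaleC_one cong: if_cong)
  then have "P \<noteq> 0"
    using norm_basis[OF e, of 0] by auto
  have "inj X"
  proof (rule injI)
    fix c c' assume "X c = X c'"
    from fun_cong[OF this, of 0] show "c = c'"
      using \<open>P \<noteq> 0\<close> by (simp add: X_def)
  qed
  obtain y where y: "y \<in> ell2" "norm_dense ell2 ell2_norm (range (\<lambda>n. (weighted_shift U W ^^ t n) y))" "ell2_norm (y - X 0) < \<epsilon>"
    using hyp X[of 0] \<open>\<epsilon> > 0\<close> unfolding densely_hypercyclic_def norm_dense_def[of _ _ "{x \<in> ell2. _ x}"] by blast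
  \<comment> \<open>The orbit points to be avoided: those with exponent at most \<open>2 * J\<close>
    and those with index at most \<open>N\<close>.\<close>
  define B where "B = (\<lambda>k. (weighted_shift U W ^^ k) y) ` ({..2 * J} \<union> t ` {..N})"
  have B: "finite B" by (simp add: B_def)
  have Tell2: "(weighted_shift U W ^^ k) y \<in> ell2" for k
    using shift_ell2(1)[OF y(1)] .
  define K where "K = (2 * real J + 1) * norm P"
  \<comment> \<open>\<open>c * K\<close> bounds the distance from \<open>X c\<close> to
    \<open>X 0\<close>, since the window has \<open>2 * J + 1\<close> entries;
    \<open>c < \<eta>\<close> keeps it below \<open>\<epsilon> / 2\<close>.\<close>
  define \<eta> where "\<eta> = \<epsilon> / (2 * (K + 1))"
  have K: "K \<ge> 0" by (simp add: K_def)
  have "\<eta> > 0"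
    using K \<open>\<epsilon> > 0\<close> by (simp add: \<eta>_def)
  then have "infinite (X ` {0<..<\<eta>})"
    using \<open>inj X\<close> by (simp add: finite_image_iff inj_on_subset infinite_Ioo)
  then obtain c where c: "0 < c" "c < \<eta>" "X c \<notin> B"
    by (meson B finite_subset greaterThanLessThan_iff image_subsetI)
  have Xc: "ell2_norm (X c - X 0) < \<epsilon> / 2"
  proof -
    have "ell2_norm (X c - X 0) \<le> (\<Sum>j\<in>{- int J..int J}. norm ((X c - X 0) j))"
      using ell2_compact[OF ell2_diff[OF X X]] by (intro ell2_finite_support(2)) (auto simp: X_def)
    also have "\<dots> = (\<Sum>j\<in>{- int J..int J}. c * norm P)"
      using c(1) by (intro sum.cong) (auto simp: X_def scaleR_left_distrib)
    also have "\<dots> = c * K"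
      by (simp add: K_def)
    also have "\<dots> \<le> c * (K + 1)"
      using c(1) by (simp add: mult_left_mono)
    also have "\<dots> < \<eta> * (K + 1)"
      using c(2) K by (intro mult_strict_right_mono) auto
    also have "\<dots> = \<epsilon> / 2"
      using K by (simp add: \<eta>_def field_simps)
    finally show ?thesis .
  qed
  \<comment> \<open>At most the distance from \<open>X c\<close> to each point of \<open>B\<close>,
    so an orbit point closer than this to \<open>X c\<close> lies outside \<open>B\<close>.\<close>
  define \<delta> where "\<delta> = Min (insert (\<epsilon> / 2) ((\<lambda>b. ell2_norm (b - X c)) ` B))"
  have "ell2_norm (b - X c) > 0" if "b \<in> B" for b
  proof -
    have "b \<in> ell2"
      using that Tell2 by (auto simp: B_def)
    moreover have "b \<noteq> X c"
      using that c(3) by blast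
    ultimately show ?thesis
      using ell2_norm_diff_eq_0[of b "X c"] X ell2_norm_nonneg[of "b - X c"] by (simp add: less_le)
  qed
  then have "\<delta> > 0"
    using B \<open>\<epsilon> > 0\<close> by (auto simp: \<delta>_def)
  then obtain n where n: "ell2_norm ((weighted_shift U W ^^ t n) y - X c) < \<delta>"
    using y(2) X[of c] unfolding norm_dense_def by blast
  have notB: "(weighted_shift U W ^^ t n) y \<notin> B"
  proof
    assume "(weighted_shift U W ^^ t n) y \<in> B"
    then have "\<delta> \<le> ell2_norm ((weighted_shift U W ^^ t n) y - X c)"
      using B unfolding \<delta>_def by (intro Min_le) auto
    with n show False by simp
  qed
  then have "n > N"
    by (metis B_def UnCI atMost_iff image_eqI not_le)
  have tn: "t n > 2 * J"
    using notB by (metis B_def UnCI atMost_iff image_eqI not_le)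
  have "\<delta> \<le> \<epsilon> / 2"
    using B unfolding \<delta>_def by (intro Min_le) auto
  then have close: "ell2_norm ((weighted_shift U W ^^ t n) y - X 0) < \<epsilon>"
    using n Xc ell2_norm_diff_triangle[OF Tell2[of "t n"] X[of c] X[of 0]] by linarith
  have y_near: "norm (y j - X 0 j) < \<epsilon>" for j
    using norm_le_ell2_norm[OF ell2_diff[OF y(1) X[of 0]], of j] y(3) by simp
  have Ty_near: "norm ((weighted_shift U W ^^ t n) y j - X 0 j) < \<epsilon>" for j
    using norm_le_ell2_norm[OF ell2_diff[OF Tell2[of "t n"] X[of 0]], of j] close by simp
  have "norm (op_prod (\<lambda>i. W (j + 1 + int i)) (t n) o\<^sub>L y j) < \<epsilon>" if "j \<in> {- int J..int J}" for j
  proof -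
    \<comment> \<open>As \<open>j \<ge> - J\<close> and \<open>t n > 2 * J\<close>, the index
      exceeds \<open>J\<close>; closeness to \<open>X 0\<close> there means smallness.\<close>
    have "X 0 (j + int (t n)) = 0"
      using that tn by (simp add: X_def)
    then show ?thesis
      using Ty_near[of "j + int (t n)"] by (simp add: norm_shift)
  qed
  moreover have "norm (op_prod (\<lambda>i. op_inverse (W (j - int i))) (t n) o\<^sub>L (weighted_shift U W ^^ t n) y j) < \<epsilon>"
    if "j \<in> {- int J..int J}" for j
  proof -
    \<comment> \<open>The mirror image: the inverse iterate of \<open>G\<close> is \<open>y\<close>
      itself, read below the window.\<close>
    have "X 0 (j - int (t n)) = 0"
      using that tn by (simp add: X_def)
    then show ?thesis
      using y_near[of "j - int (t n)"] by (simp add: shift_inverse_shift flip: norm_shift_inverse)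
  qed
  moreover have "norm (y j - P) < \<epsilon> \<and> norm ((weighted_shift U W ^^ t n) y j - P) < \<epsilon>" if "j \<in> {- int J..int J}" for j
    using y_near[of j] Ty_near[of j] that by (simp add: X_def)
  ultimately show ?thesis
    using \<open>n > N\<close> ell2_compact[OF y(1)] ell2_compact[OF Tell2[of "t n"]]
    unfolding P_def by (intro exI[of _ n] conjI exI[of _ y] exI[of _ "(weighted_shift U W ^^ t n) y"]) auto
qed

end

theorem proposition3p1:
  fixes e :: "int \<Rightarrow> 'h::complex_hilbert"
    and W :: "int \<Rightarrow> 'h \<Rightarrow>\<^sub>L 'h"
    and U :: "'h \<Rightarrow>\<^sub>L 'h"
    and t :: "nat \<Rightarrow> nat"
  assumes "orthonormal_basis e"
    and "\<And>j. invertible_op (W j)"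
    and "bounded (range W)"
    and "bounded (range (\<lambda>j. op_inverse (W j)))"
    and "unitary_op U"
    and "\<not> bdd_above (range t)"
  shows "densely_hypercyclic ell2 ell2_norm (\<lambda>n. weighted_shift U W ^^ t n) \<longleftrightarrow>
    (\<forall>J\<ge>1. \<forall>m\<ge>1. \<exists>(n :: nat \<Rightarrow> nat) (D :: int \<Rightarrow> nat \<Rightarrow> 'h \<Rightarrow>\<^sub>L 'h) (G :: int \<Rightarrow> nat \<Rightarrow> 'h \<Rightarrow>\<^sub>L 'h).
       strict_mono n \<and>
       (\<forall>i\<in>{- int J..int J}. \<forall>k. D i k \<in> compact_ops \<and> G i k \<in> compact_ops) \<and>
       (\<forall>j\<in>{- int J..int J}.
          (\<lambda>k. norm (D j k - basis_projection e m)) \<longlonglongrightarrow> 0 \<and>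
          (\<lambda>k. norm (G j k - basis_projection e m)) \<longlonglongrightarrow> 0 \<and>
          (\<lambda>k. norm (op_prod (\<lambda>i. W (j + 1 + int i)) (t (n k)) o\<^sub>L D j k)) \<longlonglongrightarrow> 0 \<and>
          (\<lambda>k. norm (op_prod (\<lambda>i. op_inverse (W (j - int i))) (t (n k)) o\<^sub>L G j k)) \<longlonglongrightarrow> 0))"
    (is "?hyp \<longleftrightarrow> ?crit")
proof -
  obtain C1 C2 where C1: "\<And>j. norm (W j) \<le> C1" and C2: "\<And>j. norm (op_inverse (W j)) \<le> C2"
    using assms(3,4) unfolding bounded_iff by auto
  define C where "C = max C1 C2"
  have C: "norm (W j) \<le> C" "norm (op_inverse (W j)) \<le> C" for j
    using C1[of j] C2[of j] by (auto simp: C_def)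
  note shift = assms(2) C assms(5)
  show ?thesis
  proof
    assume hyp: ?hyp
    show ?crit
    proof (intro allI impI)
      fix J m :: nat
      define R where "R k n D G \<longleftrightarrow> (\<forall>j. D j \<in> compact_ops \<and> G j \<in> compact_ops) \<and>
        (\<forall>j\<in>{- int J..int J}. norm (D j - basis_projection e m) < inverse (real (Suc k)) \<and>
          norm (G j - basis_projection e m) < inverse (real (Suc k)) \<and>
          norm (op_prod (\<lambda>i. W (j + 1 + int i)) (t n) o\<^sub>L D j) < inverse (real (Suc k)) \<and>
          norm (op_prod (\<lambda>i. op_inverse (W (j - int i))) (t n) o\<^sub>L G j) < inverse (real (Suc k)))"
        for k n and D G :: "int \<Rightarrow> 'h \<Rightarrow>\<^sub>L 'h"
      have step: "\<exists>n>N. \<exists>D G. R k n D G" for N k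
        unfolding R_def
        by (rule hypercyclic_imp_approximants[OF shift assms(1) hyp]) simp
      \<comment> \<open>Only the indices are chosen recursively, which makes them strictly
        increasing; the operators for each index are picked afterwards. Accuracy
        \<open>1 / (k + 1)\<close> at stage \<open>k\<close> gives the limits.\<close>
      have "\<exists>n. \<forall>k. (\<exists>D G. R k (n k) D G) \<and> n k < n (Suc k)"
      proof (rule dependent_nat_choice)
        show "\<exists>n. \<exists>D G. R 0 n D G"
          using step[of 0 0] by blast
        show "\<exists>n'. (\<exists>D G. R (Suc k) n' D G) \<and> n < n'" for n k
          using step[of n "Suc k"] by blast
      qed
      then obtain n where n: "\<And>k. \<exists>D G. R k (n k) D G" "\<And>k. n k < n (Suc k)"
        by blast
      from n(1) obtain D G where R: "\<And>k. R k (n k) (D k) (G k)"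
        by metis
      have tendsto: "f \<longlonglongrightarrow> 0" if "\<And>k. 0 \<le> f k" "\<And>k. f k < inverse (real (Suc k))" for f :: "nat \<Rightarrow> real"
        using that by (intro tendsto_sandwich[OF _ _ tendsto_const LIMSEQ_inverse_real_of_nat])
          (auto intro!: always_eventually less_imp_le simp del: of_nat_Suc)
      show "\<exists>(n :: nat \<Rightarrow> nat) (D :: int \<Rightarrow> nat \<Rightarrow> 'h \<Rightarrow>\<^sub>L 'h) (G :: int \<Rightarrow> nat \<Rightarrow> 'h \<Rightarrow>\<^sub>L 'h).
         strict_mono n \<and>
         (\<forall>i\<in>{- int J..int J}. \<forall>k. D i k \<in> compact_ops \<and> G i k \<in> compact_ops) \<and>
         (\<forall>j\<in>{- int J..int J}.
            (\<lambda>k. norm (D j k - basis_projection e m)) \<longlonglongrightarrow> 0 \<and>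
            (\<lambda>k. norm (G j k - basis_projection e m)) \<longlonglongrightarrow> 0 \<and>
            (\<lambda>k. norm (op_prod (\<lambda>i. W (j + 1 + int i)) (t (n k)) o\<^sub>L D j k)) \<longlonglongrightarrow> 0 \<and>
            (\<lambda>k. norm (op_prod (\<lambda>i. op_inverse (W (j - int i))) (t (n k)) o\<^sub>L G j k)) \<longlonglongrightarrow> 0)"
      proof (rule exI[of _ n], rule exI[of _ "\<lambda>j k. D k j"], rule exI[of _ "\<lambda>j k. G k j"], intro conjI ballI allI)
        show "strict_mono n"
          using n(2) by (simp add: strict_mono_Suc_iff)
      qed (use R in \<open>auto simp: R_def simp del: of_nat_Suc intro!: tendsto\<close>)
    qed
  next
    assume crit: ?crit
    obtain S :: "(int \<Rightarrow> 'h \<Rightarrow>\<^sub>L 'h) set" where S: "countable S" "norm_dense ell2 ell2_norm S"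
      using ell2_separable[OF assms(1)] .
    show ?hyp
    proof (rule transitive_imp_densely_hypercyclic[OF _ _ _ _ _ S])
      show "\<exists>n. \<exists>u\<in>ell2. ell2_norm (u - x) < \<epsilon> \<and> ell2_norm ((weighted_shift U W ^^ t n) u - y) < \<epsilon>"
        if x: "x \<in> ell2" and y: "y \<in> ell2" and "\<epsilon> > 0" for x y :: "int \<Rightarrow> 'h \<Rightarrow>\<^sub>L 'h" and \<epsilon> :: real
      proof -
        have "\<epsilon> / 2 > 0" using \<open>\<epsilon> > 0\<close> by simp
        obtain Jx mx x' where x': "x' \<in> ell2" "\<And>j. j \<notin> {- int Jx..int Jx} \<Longrightarrow> x' j = 0"
          "\<And>j m. mx \<le> m \<Longrightarrow> basis_projection e m o\<^sub>L x' j = x' j" "ell2_norm (x' - x) < \<epsilon> / 2"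
          using ell2_approx_basis_projection[OF assms(1) x \<open>\<epsilon> / 2 > 0\<close>] by metis
        obtain Jy my y' where y': "y' \<in> ell2" "\<And>j. j \<notin> {- int Jy..int Jy} \<Longrightarrow> y' j = 0"
          "\<And>j m. my \<le> m \<Longrightarrow> basis_projection e m o\<^sub>L y' j = y' j" "ell2_norm (y' - y) < \<epsilon> / 2"
          using ell2_approx_basis_projection[OF assms(1) y \<open>\<epsilon> / 2 > 0\<close>] by metis
        \<comment> \<open>A common window and a common projection for both vectors; the maximum with
          1 meets the range of the quantifiers in the criterion.\<close>
        define J m where "J = max 1 (max Jx Jy)" and "m = max 1 (max mx my)"
        have "1 \<le> J" "1 \<le> m"
          by (simp_all add: J_def m_def)
        from crit[rule_format, OF this] obtain n D G where
          "\<forall>i\<in>{- int J..int J}. \<forall>k. D i k \<in> compact_ops \<and> G i k \<in> compact_ops"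
          "\<forall>j\<in>{- int J..int J}.
            (\<lambda>k. norm (D j k - basis_projection e m)) \<longlonglongrightarrow> 0 \<and>
            (\<lambda>k. norm (G j k - basis_projection e m)) \<longlonglongrightarrow> 0 \<and>
            (\<lambda>k. norm (op_prod (\<lambda>i. W (j + 1 + int i)) (t (n k)) o\<^sub>L D j k)) \<longlonglongrightarrow> 0 \<and>
            (\<lambda>k. norm (op_prod (\<lambda>i. op_inverse (W (j - int i))) (t (n k)) o\<^sub>L G j k)) \<longlonglongrightarrow> 0"
          by (elim exE conjE)
        note DG = this(1)[rule_format] this(2)[THEN bspec, THEN conjunct1]
          this(2)[THEN bspec, THEN conjunct2, THEN conjunct1]
          this(2)[THEN bspec, THEN conjunct2, THEN conjunct2, THEN conjunct1]
          this(2)[THEN bspec, THEN conjunct2, THEN conjunct2, THEN conjunct2]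
        have "x' j = 0" "y' j = 0" if "j \<notin> {- int J..int J}" for j
          using that by (auto simp: J_def intro!: x'(2) y'(2))
        moreover have "basis_projection e m o\<^sub>L x' j = x' j" "basis_projection e m o\<^sub>L y' j = y' j" for j
          by (auto simp: m_def intro!: x'(3) y'(3))
        ultimately obtain k u where u: "u \<in> ell2" "ell2_norm (u - x') < \<epsilon> / 2"
          "ell2_norm ((weighted_shift U W ^^ t (n k)) u - y') < \<epsilon> / 2"
          using criterion_imp_transitive[OF shift DG x'(1) _ _ y'(1) _ _ \<open>\<epsilon> / 2 > 0\<close>] by blast
        have "ell2_norm (u - x) < \<epsilon>"
          using ell2_norm_diff_triangle[OF u(1) x'(1) x] u(2) x'(4) by linarith
        moreover have "ell2_norm ((weighted_shift U W ^^ t (n k)) u - y) < \<epsilon>"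
          using ell2_norm_diff_triangle[OF shift_ell2(1)[where W = W and n = "t (n k)", OF shift u(1)] y'(1) y] u(3) y'(4) by linarith
        ultimately show ?thesis
          using u(1) by blast
      qed
    qed (auto intro: ell2_norm_nonneg ell2_norm_minus_commute ell2_norm_diff_triangle ell2_complete
        shift_ell2(1)[where W = W, OF shift] shift_continuous[where W = W, OF shift] simp: ell2_norm_diff_eq_0)
  qed
qed

end
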